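(* Let $M=\{u_1,\ldots,u_N\}\subset\mathbb{S}^{n-1}$ be a finite set of $N$ points, let $\xi$ be a spherically contoured random vector in $\mathbb{R}^n$, and $T_i=\langle u_i,\xi\rangle$. Suppose that the distribution function $F_{R_n}$ of $R_n=\|\xi\|^2$ belongs to $\mathrm{RV}_{-\gamma}$ with $\gamma\in(0,+\infty)$. Let $\bar\Delta=\mathbb{P}(\widetilde B<\cos^2\theta_* )$, where $\widetilde B$ has the Beta distribution $B_{\gamma+\frac12,\frac{n-1}{2}}$. Then, for all sufficiently large $c$, $$ (1-\bar\Delta)\, N\, \mathbb{P}(T_1 \ge c) < \mathbb{P}\Bigl(\max_{1\le i\le N}T_i \ge c\Bigr) < N\, \mathbb{P}(T_1 \ge c). $$
   Context: $n\ge2$. A spherically contoured random vector is $\xi=r\eta$, where $\eta$ is uniformly distributed on the unit sphere $\mathbb{S}^{n-1}$ and $r>0$ is a random variable independent of $\eta$; $R_n=r^2=\|\xi\|^2$. The critical radius $\theta_*\in[0,\pi/2]$ of $M$ is given by $\cos\theta_*=\sqrt{(1+\rho_* )/2}$ with $\rho_*=\max_{i\ne j}\langle u_i,u_j\rangle$. $F\in\mathrm{RV}_{-\gamma}$ means $F(x)<1$ for all $x>0$ and $\bar F(\lambda x)/\bar F(x)\to\lambda^{-\gamma}$ as $x\to+\infty$ for all $\lambda>0$, where $\bar F=1-F$. $B_{p,q}$ is the Beta distribution with parameters $p,q>0$.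
   Formalization: Antipodal pairs (N=2) and regular polygons in the plane (n=2) are excluded: for an antipodal pair both bounds are equalities for c>0, and for a planar regular N-gon with Pareto tail of R_n the lower bound is an equality for large c. N≥2 is assumed so that ρ_* is defined. *)

theory Defs
  imports "HOL-Probability.Probability"
begin

text \<open>Uniform distribution on the unit sphere: the direction of a uniform point of the unit ball
  (the cone measure, i.e. normalised surface measure). Together with
  \<open>orthogonal_invariant_uniform_sphere\<close> below, this is the rotation-invariant probability on the
  sphere. The origin, a null set, is sent to \<open>0\<close>.\<close>

definition uniform_sphere :: "'a::euclidean_space measure" where
  "uniform_sphere = distr (uniform_measure lborel (ball 0 1)) borel (\<lambda>x. x /\<^sub>R norm x)"

text \<open>Independence of \<open>r\<close> and \<open>\<eta>\<close> is stated through the generated sigma algebras, because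
  \<open>indep_var\<close> requires both variables to have the same range type.\<close>

definition spherically_contoured :: "'w measure \<Rightarrow> ('w \<Rightarrow> 'a::euclidean_space) \<Rightarrow> bool" where
  "spherically_contoured P \<xi> \<longleftrightarrow>
     (\<exists>(r :: 'w \<Rightarrow> real) (\<eta> :: 'w \<Rightarrow> 'a). r \<in> borel_measurable P \<and> \<eta> \<in> borel_measurable P \<and>
        prob_space.indep_set P (sets (vimage_algebra (space P) r borel))
                               (sets (vimage_algebra (space P) \<eta> borel)) \<and>
        (AE \<omega> in P. r \<omega> > 0) \<and>
        distr P borel \<eta> = uniform_sphere \<and>
        (\<forall>\<omega>\<in>space P. \<xi> \<omega> = r \<omega> *\<^sub>R \<eta> \<omega>))"

definition max_correlation :: "'a::real_inner set \<Rightarrow> real" where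
  "max_correlation M = Max {x \<bullet> y | x y. x \<in> M \<and> y \<in> M \<and> x \<noteq> y}"

definition critical_radius :: "'a::real_inner set \<Rightarrow> real" where
  "critical_radius M = arccos (sqrt ((1 + max_correlation M) / 2))"

text \<open>Membership of a distribution function in \<open>RV\<^sub>-\<^sub>\<gamma>\<close>; the index is \<open>-\<gamma>\<close>.\<close>

definition RV_neg :: "real \<Rightarrow> (real \<Rightarrow> real) set" where
  "RV_neg \<gamma> = {F. (\<forall>x>0. F x < 1) \<and>
     (\<forall>t>0. ((\<lambda>x. (1 - F (t * x)) / (1 - F x)) \<longlongrightarrow> t powr (- \<gamma>)) at_top)}"

definition beta_density :: "real \<Rightarrow> real \<Rightarrow> real \<Rightarrow> real" where
  "beta_density p q x =
     (if 0 < x \<and> x < 1 then x powr (p - 1) * (1 - x) powr (q - 1) / Beta p q else 0)"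

definition beta_distribution :: "real \<Rightarrow> real \<Rightarrow> real measure" where
  "beta_distribution p q = density lborel (\<lambda>x. ennreal (beta_density p q x))"

text \<open>Vertex sets of regular polygons inscribed in a great circle; for two points this means an
  antipodal pair. Regular polygons in the plane, and antipodal pairs in any dimension, are the
  configurations whose closed caps of radius \<open>\<theta>\<^sub>*\<close> cover the whole sphere. For them the strict
  two-sided bound fails. An antipodal pair gives equality in both bounds for \<open>c > 0\<close>. A plane
  regular polygon gives equality in the lower bound, for large \<open>c\<close>, when the squared radius has the
  Pareto tail \<open>x powr - \<gamma>\<close> for \<open>x \<ge> 1\<close>. They therefore have to be excluded.\<close>

definition regular_polygon :: "'a::real_inner set \<Rightarrow> bool" where
  "regular_polygon M \<longleftrightarrow>
     (\<exists>e f. norm e = 1 \<and> norm f = 1 \<and> e \<bullet> f = 0 \<and>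
        M = (\<lambda>k. cos (2 * pi * real k / real (card M)) *\<^sub>R e +
                 sin (2 * pi * real k / real (card M)) *\<^sub>R f) ` {..<card M})"

lemma emeasure_ball_01: "emeasure lborel (ball (0::'a::euclidean_space) 1) \<noteq> 0"
  "emeasure lborel (ball (0::'a::euclidean_space) 1) \<noteq> \<infinity>"
proof -
  have "measure lborel (ball (0::'a) 1) > 0"
    using content_ball_pos[of 1 "0::'a"] by simp
  then show "emeasure lborel (ball (0::'a) 1) \<noteq> 0"
    by (metis enn2real_0 less_irrefl measure_def)
  show "emeasure lborel (ball (0::'a) 1) \<noteq> \<infinity>"
    using emeasure_lborel_ball_finite[of "0::'a" 1] by auto
qed

lemma nn_integral_lborel_reflect:
  fixes f :: "'a::euclidean_space \<Rightarrow> ennreal"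
  assumes [measurable]: "f \<in> borel_measurable borel"
  shows "(\<integral>\<^sup>+y. f (x - y) \<partial>lborel) = (\<integral>\<^sup>+y. f y \<partial>lborel)"
proof -
  have "lborel = distr lborel borel (\<lambda>y::'a. x - y)"
    using lborel_affine[of "-1" x] by (simp add: density_1)
  then have "(\<integral>\<^sup>+y. f y \<partial>lborel) = (\<integral>\<^sup>+y. f y \<partial>distr lborel borel (\<lambda>y. x - y))" by simp
  then show ?thesis by (simp add: nn_integral_distr)
qed

lemma nn_integral_lborel_shift:
  fixes f :: "'a::euclidean_space \<Rightarrow> ennreal"
  assumes [measurable]: "f \<in> borel_measurable borel"
  shows "(\<integral>\<^sup>+y. f (x + y) \<partial>lborel) = (\<integral>\<^sup>+y. f y \<partial>lborel)"
  using lborel_distr_plus[of x] nn_integral_distr[of "(+) x" lborel borel f] by simp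

lemma lborel_distr_orthogonal:
  fixes T :: "'a::euclidean_space \<Rightarrow> 'a"
  assumes T: "orthogonal_transformation T"
  shows "distr lborel borel T = lborel"
proof (rule measure_eqI)
  have lin: "linear T"
    using T by (rule orthogonal_transformation_linear)
  have mT[measurable]: "T \<in> borel_measurable borel"
    using lin by (intro borel_measurable_continuous_onI linear_continuous_on)
      (simp add: linear_conv_bounded_linear)
  fix A assume "A \<in> sets (distr lborel borel T)"
  then have A[measurable]: "A \<in> sets borel" by simp
  let ?C = "ball (0::'a) 1" and ?c = "emeasure lborel (ball (0::'a) 1)"
  have surj: "\<exists>z. y = T z" for y
    using orthogonal_transformation_surj[OF T] by (metis surjD)
  have 1: "(\<integral>\<^sup>+x. indicator ?C (T x - y) \<partial>lborel) = ?c" for y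
  proof -
    obtain z where z: "y = T z" using surj by blast
    have "indicator ?C (T x - y) = (indicator ?C (- z + x) :: ennreal)" for x
      using orthogonal_transformation_norm[OF T, of "x - z"]
      by (auto simp: z linear_diff[OF lin] indicator_def)
    then have "(\<integral>\<^sup>+x. indicator ?C (T x - y) \<partial>lborel) = (\<integral>\<^sup>+x. indicator ?C (- z + x) \<partial>lborel)"
      by presburger
    also have "\<dots> = ?c"
      by (subst nn_integral_lborel_shift) (simp_all add: borel_measurable_indicator)
    finally show ?thesis .
  qed
  have 2: "(\<integral>\<^sup>+x. indicator A (T x - y) \<partial>lborel) = emeasure (distr lborel borel T) A" for y
  proof -
    obtain z where z: "y = T z" using surj by blast
    have "(\<integral>\<^sup>+x. indicator A (T x - y) \<partial>lborel) =
        (\<integral>\<^sup>+x. (indicator A \<circ> T) (- z + x) \<partial>lborel)"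
      by (simp add: z linear_diff[OF lin] linear_add[OF lin] linear_neg[OF lin] comp_def)
    also have "\<dots> = (\<integral>\<^sup>+x. indicator A (T x) \<partial>lborel)"
      by (subst nn_integral_lborel_shift) (simp_all add: comp_def)
    also have "\<dots> = (\<integral>\<^sup>+x. indicator A x \<partial>distr lborel borel T)"
      by (rule nn_integral_distr[symmetric]) simp_all
    finally show ?thesis by simp
  qed
  define a c :: "'a \<Rightarrow> ennreal" where "a = indicator A" and "c = indicator ?C"
  have [measurable]: "a \<in> borel_measurable borel" "c \<in> borel_measurable borel"
    by (simp_all add: a_def c_def borel_measurable_indicator)
  note 1 = 1[folded c_def] and 2 = 2[folded a_def]
  have ia: "emeasure lborel A = (\<integral>\<^sup>+y. a y \<partial>lborel)" and ic: "?c = (\<integral>\<^sup>+y. c y \<partial>lborel)"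
    by (simp_all add: a_def c_def borel_measurable_indicator)
  have "emeasure lborel A * ?c = (\<integral>\<^sup>+y. a y * (\<integral>\<^sup>+x. c (T x - y) \<partial>lborel) \<partial>lborel)"
    unfolding 1 ia by (simp add: nn_integral_multc)
  also have "\<dots> = (\<integral>\<^sup>+y. (\<integral>\<^sup>+x. a y * c (T x - y) \<partial>lborel) \<partial>lborel)"
    by (simp add: nn_integral_cmult)
  also have "\<dots> = (\<integral>\<^sup>+x. (\<integral>\<^sup>+y. a y * c (T x - y) \<partial>lborel) \<partial>lborel)"
    by (rule lborel_pair.Fubini') measurable
  also have "\<dots> = (\<integral>\<^sup>+x. (\<integral>\<^sup>+y. a (T x - y) * c y \<partial>lborel) \<partial>lborel)"
  proof (rule nn_integral_cong)
    fix x
    show "(\<integral>\<^sup>+y. a y * c (T x - y) \<partial>lborel) = (\<integral>\<^sup>+y. a (T x - y) * c y \<partial>lborel)"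
      using nn_integral_lborel_reflect[of "\<lambda>y. a (T x - y) * c y" "T x"] by simp
  qed
  also have "\<dots> = (\<integral>\<^sup>+y. (\<integral>\<^sup>+x. a (T x - y) * c y \<partial>lborel) \<partial>lborel)"
    by (rule lborel_pair.Fubini') measurable
  also have "\<dots> = (\<integral>\<^sup>+y. emeasure (distr lborel borel T) A * c y \<partial>lborel)"
    by (simp add: nn_integral_multc 2)
  also have "\<dots> = emeasure (distr lborel borel T) A * ?c"
    unfolding ic by (simp add: nn_integral_cmult)
  finally show "emeasure (distr lborel borel T) A = emeasure lborel A"
    using emeasure_ball_01[where 'a='a]
    by (metis mult_divide_eq_ennreal infinity_ennreal_def)
qed simp

lemma prob_space_uniform_sphere: "prob_space (uniform_sphere :: 'a::euclidean_space measure)"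
  unfolding uniform_sphere_def
  by (intro prob_space.prob_space_distr prob_space_uniform_measure emeasure_ball_01) simp

lemma AE_uniform_sphere: "AE x in (uniform_sphere :: 'a::euclidean_space measure). x \<in> sphere 0 1"
proof -
  have "AE x in lborel. x \<in> ball (0::'a) 1 \<longrightarrow> norm (x /\<^sub>R norm x) = 1"
    using AE_lborel_singleton[of "0::'a"] by eventually_elim simp
  then have "AE x in uniform_measure lborel (ball (0::'a) 1). norm (x /\<^sub>R norm x) = 1"
    by (subst AE_uniform_measure) (use emeasure_ball_01[where 'a='a] in \<open>auto simp: less_top\<close>)
  then show ?thesis
    unfolding uniform_sphere_def by (subst AE_distr_iff) simp_all
qed

lemma orthogonal_invariant_uniform_sphere:
  fixes T :: "'a::euclidean_space \<Rightarrow> 'a"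
  assumes T: "orthogonal_transformation T"
  shows "distr uniform_sphere borel T = uniform_sphere"
proof (rule measure_eqI)
  have lin: "linear T"
    using T by (rule orthogonal_transformation_linear)
  have mT[measurable]: "T \<in> borel_measurable borel"
    using lin by (intro borel_measurable_continuous_onI linear_continuous_on)
      (simp add: linear_conv_bounded_linear)
  define g where "g = (\<lambda>x::'a. x /\<^sub>R norm x)"
  have g[measurable]: "g \<in> borel_measurable borel" unfolding g_def by simp
  have us: "uniform_sphere = distr (uniform_measure lborel (ball 0 1)) borel g"
    by (simp add: uniform_sphere_def g_def)
  have Tg: "T (g x) = g (T x)" for x
    by (simp add: g_def orthogonal_transformation_norm[OF T] linear_cmul[OF lin])
  show "sets (distr uniform_sphere borel T) = sets (uniform_sphere :: 'a measure)"
    by (simp add: us)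
  fix B assume "B \<in> sets (distr uniform_sphere borel T)"
  then have B[measurable]: "B \<in> sets borel" by simp
  define A where "A = ball 0 1 \<inter> g -` B"
  have gB: "g -` S \<in> sets borel" if "S \<in> sets borel" for S
    using measurable_sets[OF g that] by simp
  have TB: "T -` S \<in> sets borel" if "S \<in> sets borel" for S
    using measurable_sets[OF mT that] by simp
  have A: "A \<in> sets borel"
    unfolding A_def using gB[OF B] by auto
  have "T -` A = ball 0 1 \<inter> g -` T -` B"
    by (auto simp: A_def Tg orthogonal_transformation_norm[OF T])
  then have eq: "emeasure lborel (ball 0 1 \<inter> g -` T -` B) = emeasure lborel A"
    using emeasure_distr[of T lborel borel A] A lborel_distr_orthogonal[OF T] by simp
  show "emeasure (distr uniform_sphere borel T) B = emeasure uniform_sphere B"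
    using eq gB[OF TB[OF B]] gB[OF B] B TB[OF B]
    by (simp add: us emeasure_distr A_def)
qed

end

theory Submission
  imports Defs
begin

text \<open>
  Put \<open>k = cos \<theta>\<^sub>*\<close>. The open caps \<open>u\<^sub>i \<bullet> \<eta> > k\<close> are pairwise disjoint, so the probability of the union
  is at least the sum over \<open>i\<close> of \<open>P(T\<^sub>i \<ge> c, u\<^sub>i \<bullet> \<eta> > k)\<close>, plus a contribution of the directions outside
  all the caps. Regular variation and dominated convergence show that \<open>P(T\<^sub>i \<ge> c, \<eta> \<in> A) / P(r > c)\<close>
  tends to the integral of \<open>(u\<^sub>i \<bullet> v) powr (2 * \<gamma>)\<close> over \<open>v \<in> A\<close>. Since \<open>(u\<^sub>i \<bullet> \<eta>)\<^sup>2\<close> has a Beta law with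
  parameters \<open>1/2\<close> and \<open>(n-1)/2\<close>, weighting it by its \<open>\<gamma>\<close>-th power gives the Beta law of the theorem, and
  the caps account exactly for the factor \<open>1 - \<Delta>\<close>. Strictness comes from an open set of directions that
  see some \<open>u\<^sub>i\<close> but lie outside all closed caps: it exists next to any boundary point of a cap that no
  other closed cap contains. Two closed caps meet in at most one point, so from dimension 3 on such a
  boundary point exists; in the plane its absence makes the configuration invariant under rotation by
  \<open>2\<theta>\<^sub>*\<close>, hence a regular polygon. The upper bound is the union bound, strict because the half-spaces of
  two non-antipodal points overlap.
\<close>

section \<open>The law of a coordinate on the sphere\<close>

text \<open>The radius enters through its square \<open>\<rho>\<close>, because fibres of the ball
  appear below as sublevel sets of a sum of squares. For \<open>\<rho> > 0\<close> this is the
  volume formula for balls. At \<open>\<rho> = 0\<close> the set lies in every ball of positive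
  radius, whose volume tends to 0 since \<open>A\<close> is nonempty.\<close>

lemma emeasure_PiM_sum_squares_le:
  fixes \<rho> :: real
  assumes A: "finite A" "A \<noteq> {}" and \<rho>: "\<rho> \<ge> 0"
  shows "emeasure (Pi\<^sub>M A (\<lambda>_. lborel)) {y \<in> space (Pi\<^sub>M A (\<lambda>_. lborel)). (\<Sum>i\<in>A. (y i)\<^sup>2) \<le> \<rho>}
    = ennreal (unit_ball_vol (real (card A)) * \<rho> powr (real (card A) / 2))" (is "emeasure ?M (?B \<rho>) = _")
proof -
  have pos: "emeasure ?M (?B r) = ennreal (unit_ball_vol (real (card A)) * r powr (real (card A) / 2))"
    if r: "r > 0" for r
  proof -
    have "?B r = {f. sqrt (\<Sum>i\<in>A. (f i)\<^sup>2) \<le> sqrt r} \<inter> space ?M"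
      by auto
    moreover have "sqrt r ^ card A = r powr (real (card A) / 2)"
      using r by (simp add: powr_half_sqrt[symmetric] powr_realpow[symmetric] powr_powr)
    ultimately show ?thesis
      using emeasure_cball_aux[OF A(1), of "sqrt r"] r by simp
  qed
  show ?thesis
  proof (cases "\<rho> = 0")
    case True
    have c: "real (card A) / 2 > 0" using A by (simp add: card_gt_0_iff)
    have "((\<lambda>r. ennreal (unit_ball_vol (real (card A)) * r powr (real (card A) / 2))) \<longlongrightarrow>
        ennreal (unit_ball_vol (real (card A)) * 0 powr (real (card A) / 2))) (at_right 0)"
      using c by (intro tendsto_intros) (auto simp: eventually_at_right_less le_less
          intro!: eventually_at_rightI[of 0 1])
    moreover have "eventually (\<lambda>r. emeasure ?M (?B 0) \<le>
        ennreal (unit_ball_vol (real (card A)) * r powr (real (card A) / 2))) (at_right 0)"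
      unfolding eventually_at_right_field
    proof (intro exI[of _ 1] conjI allI impI)
      fix r :: real assume "r > 0"
      then show "emeasure ?M (?B 0) \<le> ennreal (unit_ball_vol (real (card A)) * r powr (real (card A) / 2))"
        unfolding pos[OF \<open>r > 0\<close>, symmetric] by (intro emeasure_mono) auto
    qed simp
    ultimately have "emeasure ?M (?B 0) \<le> ennreal (unit_ball_vol (real (card A)) * 0 powr (real (card A) / 2))"
      by (rule tendsto_lowerbound) simp
    then show ?thesis using True c by simp
  qed (use pos \<rho> in simp)
qed

text \<open>The derivative of \<open>a / (1 - a)\<close> is the inverse square of
  \<open>1 - a\<close>, so \<open>2 / m * (a / (1 - a)) powr (m / 2)\<close> is an antiderivative.
  It is differentiated only in the interior, since for \<open>m < 2\<close> the integrand is
  unbounded near 0.\<close>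

lemma nn_integral_ratio_powr:
  fixes m x :: real
  assumes m: "m > 0" and x: "0 \<le> x" "x < 1"
  shows "(\<integral>\<^sup>+a. indicator {0..x} a * ennreal (a powr (m/2 - 1) * (1 - a) powr (- m/2 - 1)) \<partial>lborel)
    = ennreal (2 / m * (x / (1 - x)) powr (m / 2))"
proof -
  have "((\<lambda>a. a powr (m/2 - 1) * (1 - a) powr (- m/2 - 1)) has_integral
      (2 / m * (x / (1 - x)) powr (m / 2) - 2 / m * (0 / (1 - 0)) powr (m / 2))) {0..x}"
  proof (rule fundamental_theorem_of_calculus_interior)
    show "continuous_on {0..x} (\<lambda>a. 2 / m * (a / (1 - a)) powr (m / 2))"
      using x m by (intro continuous_intros continuous_on_powr') auto
    fix a assume a: "a \<in> {0<..<x}"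
    have "(a / (1 - a)) powr (m/2 - 1) / (1 - a)\<^sup>2 = a powr (m/2 - 1) * (1 - a) powr (- m/2 - 1)"
    proof -
      have "(a / (1 - a)) powr (m/2 - 1) / (1 - a)\<^sup>2
        = a powr (m/2 - 1) * ((1 - a) powr (- (m/2 - 1)) * (1 - a) powr (-2))"
        using a x by (simp add: powr_divide powr_minus field_simps)
      also have "(1 - a) powr (- (m/2 - 1)) * (1 - a) powr (-2) = (1 - a) powr (- m/2 - 1)"
        by (simp only: powr_add[symmetric]) (rule arg_cong[where f = "(powr) (1 - a)"], simp)
      finally show ?thesis .
    qed
    moreover have "((\<lambda>a. 2 / m * (a / (1 - a)) powr (m / 2)) has_real_derivative
        (a / (1 - a)) powr (m/2 - 1) / (1 - a)\<^sup>2) (at a)"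
      using a x m
      apply (auto intro!: derivative_eq_intros)
      apply (simp add: field_simps power2_eq_square)
      done
    ultimately show "((\<lambda>a. 2 / m * (a / (1 - a)) powr (m / 2)) has_vector_derivative
        a powr (m/2 - 1) * (1 - a) powr (- m/2 - 1)) (at a)"
      by (simp add: has_real_derivative_iff_has_vector_derivative)
  qed (use x in auto)
  then have "((\<lambda>a. a powr (m/2 - 1) * (1 - a) powr (- m/2 - 1)) has_integral
      (2 / m * (x / (1 - x)) powr (m / 2))) {0..x}" using m by simp
  from nn_integral_has_integral_lebesgue[OF _ this] x show ?thesis
    by (simp add: ennreal_mult' ennreal_indicator)
qed

lemma nn_integral_power_Icc:
  fixes x :: real
  assumes "x \<ge> 0"
  shows "(\<integral>\<^sup>+t. indicator {0..x} t * ennreal (t ^ m) \<partial>lborel) = ennreal (x ^ Suc m / real (Suc m))"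
proof -
  have "((\<lambda>t. t ^ m) has_integral (x ^ Suc m / real (Suc m) - 0 ^ Suc m / real (Suc m))) {0..x}"
  proof (intro fundamental_theorem_of_calculus)
    fix t :: real
    have "((\<lambda>t. t ^ Suc m / real (Suc m)) has_real_derivative real (Suc m) * t ^ m / real (Suc m)) (at t within {0..x})"
      using DERIV_cdivide[OF DERIV_pow[of "Suc m" t "{0..x}"], of "real (Suc m)"] by simp
    then show "((\<lambda>t. t ^ Suc m / real (Suc m)) has_vector_derivative t ^ m) (at t within {0..x})"
      by (simp add: has_real_derivative_iff_has_vector_derivative del: of_nat_Suc)
  qed (use assms in auto)
  then have "((\<lambda>t. t ^ m) has_integral (x ^ Suc m / real (Suc m))) {0..x}" by simp
  from nn_integral_has_integral_lebesgue[OF _ this] assms show ?thesis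
    by (simp add: ennreal_mult' ennreal_indicator)
qed

text \<open>The fibre of the unit ball over height \<open>t\<close>, pushed forward under the squared sine of the
  angle with the axis.\<close>

lemma distr_sq_sine_fibre:
  fixes t :: real and A :: "'i set"
  assumes A: "finite A" "A \<noteq> {}" and t: "0 < t" "t < 1"
  defines "m \<equiv> card A"
  defines "M \<equiv> Pi\<^sub>M A (\<lambda>_. lborel :: real measure)"
  shows "distr (density M (\<lambda>y. indicator {..1 - t\<^sup>2} (\<Sum>i\<in>A. (y i)\<^sup>2))) borel
      (\<lambda>y. (\<Sum>i\<in>A. (y i)\<^sup>2) / (t\<^sup>2 + (\<Sum>i\<in>A. (y i)\<^sup>2)))
    = density lborel (\<lambda>a. ennreal (unit_ball_vol m * m / 2 * t ^ m) *
        (indicator {0..1 - t\<^sup>2} a * ennreal (a powr (real m/2 - 1) * (1 - a) powr (- real m/2 - 1))))"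
    (is "?D = ?E")
proof -
  have m: "m > 0" using A by (simp add: m_def card_gt_0_iff)
  have t2: "0 < t\<^sup>2" "t\<^sup>2 < 1" using t by (auto simp: power_less_one_iff abs_square_less_1)
  have [measurable]: "(\<lambda>y. \<Sum>i\<in>A. (y i)\<^sup>2) \<in> borel_measurable M"
    unfolding M_def by measurable
  let ?s = "\<lambda>y::'i \<Rightarrow> real. \<Sum>i\<in>A. (y i)\<^sup>2"
  have D: "emeasure ?D {..x} = ennreal (if x < 0 then 0 else
      unit_ball_vol m * (t\<^sup>2 * min x (1 - t\<^sup>2) / (1 - min x (1 - t\<^sup>2))) powr (m / 2))" for x
  proof -
    \<comment> \<open>The cut-off \<open>?s y \<le> 1 - t\<^sup>2\<close> says that the quotient is
      at most \<open>1 - t\<^sup>2\<close>. Both constraints therefore merge into a single one at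
      the smaller threshold \<open>z\<close>, and the mass is a ball volume.\<close>
    define z where "z = min x (1 - t\<^sup>2)"
    have z1: "z < 1" using t2 by (simp add: z_def min_less_iff_disj)
    have "emeasure ?D {..x} = (\<integral>\<^sup>+y. indicator {..1 - t\<^sup>2} (?s y) * indicator {..x} (?s y / (t\<^sup>2 + ?s y)) \<partial>M)"
      by (subst emeasure_distr)
        (auto simp: emeasure_density intro!: nn_integral_cong split: split_indicator)
    also have "\<dots> = (\<integral>\<^sup>+y. indicator {y \<in> space M. ?s y \<le> t\<^sup>2 * z / (1 - z)} y \<partial>M)"
    proof (intro nn_integral_cong)
      fix y assume y: "y \<in> space M"
      have s: "?s y \<ge> 0" by (simp add: sum_nonneg)
      have *: "?s y / (t\<^sup>2 + ?s y) \<le> w \<longleftrightarrow> ?s y \<le> t\<^sup>2 * w / (1 - w)" if "w < 1" for w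
        using s t2 that by (simp add: field_simps pos_divide_le_eq add_pos_nonneg)
      have "?s y \<le> 1 - t\<^sup>2 \<longleftrightarrow> ?s y / (t\<^sup>2 + ?s y) \<le> 1 - t\<^sup>2"
        using *[of "1 - t\<^sup>2"] t2 by simp
      then have "?s y \<le> 1 - t\<^sup>2 \<and> ?s y / (t\<^sup>2 + ?s y) \<le> x \<longleftrightarrow> ?s y \<le> t\<^sup>2 * z / (1 - z)"
        using *[OF z1] by (auto simp: z_def)
      then show "indicator {..1 - t\<^sup>2} (?s y) * indicator {..x} (?s y / (t\<^sup>2 + ?s y))
          = (indicator {y \<in> space M. ?s y \<le> t\<^sup>2 * z / (1 - z)} y :: ennreal)"
        using y by (auto split: split_indicator)
    qed
    also have "\<dots> = emeasure M {y \<in> space M. ?s y \<le> t\<^sup>2 * z / (1 - z)}"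
      by (rule nn_integral_indicator) measurable
    also have "\<dots> = ennreal (if x < 0 then 0 else unit_ball_vol m * (t\<^sup>2 * z / (1 - z)) powr (m / 2))"
    proof (cases "x < 0")
      case True
      then have "t\<^sup>2 * z / (1 - z) < 0" using t2 z1 by (simp add: z_def divide_simps mult_less_0_iff)
      then have "{y \<in> space M. ?s y \<le> t\<^sup>2 * z / (1 - z)} = {}"
        by (smt (verit, best) Collect_empty_eq sum_nonneg zero_le_power2)
      then show ?thesis using True by (simp only:) simp
    next
      case False
      then have "t\<^sup>2 * z / (1 - z) \<ge> 0" using t2 z1 by (simp add: z_def)
      then show ?thesis
        using False emeasure_PiM_sum_squares_le[OF A, of "t\<^sup>2 * z / (1 - z)"]
        by (simp add: M_def m_def)
    qed
    finally show ?thesis by (simp add: z_def)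
  qed
  have E: "emeasure ?E {..x} = ennreal (if x < 0 then 0 else
      unit_ball_vol m * (t\<^sup>2 * min x (1 - t\<^sup>2) / (1 - min x (1 - t\<^sup>2))) powr (m / 2))" for x
  proof -
    define z where "z = min x (1 - t\<^sup>2)"
    have z1: "z < 1" using t2 by (simp add: z_def min_less_iff_disj)
    let ?h = "\<lambda>a. ennreal (a powr (real m/2 - 1) * (1 - a) powr (- real m/2 - 1))"
    have "emeasure ?E {..x} = (\<integral>\<^sup>+a. ennreal (unit_ball_vol m * m / 2 * t ^ m) *
        (indicator {0..z} a * ?h a) \<partial>lborel)"
      by (subst emeasure_density)
        (auto simp: z_def intro!: nn_integral_cong split: split_indicator)
    also have "\<dots> = ennreal (unit_ball_vol m * m / 2 * t ^ m) * (\<integral>\<^sup>+a. indicator {0..z} a * ?h a \<partial>lborel)"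
      by (rule nn_integral_cmult) measurable
    also have "\<dots> = ennreal (if x < 0 then 0 else unit_ball_vol m * (t\<^sup>2 * z / (1 - z)) powr (m / 2))"
    proof (cases "x < 0")
      case False
      then have z0: "z \<ge> 0" using t2 by (simp add: z_def)
      have "t ^ m = (t\<^sup>2) powr (m / 2)"
        using t by (simp add: powr_realpow[symmetric] powr_powr powr_numeral[symmetric] del: powr_numeral)
      then have "unit_ball_vol m * m / 2 * t ^ m * (2 / m * (z / (1 - z)) powr (m / 2))
          = unit_ball_vol m * (t\<^sup>2 * z / (1 - z)) powr (m / 2)"
        using m z0 z1 by (simp add: powr_mult powr_divide)
      then show ?thesis
        using False m z0 z1 t
        by (subst nn_integral_ratio_powr) (auto simp: ennreal_mult'[symmetric] simp del: times_divide_eq_left times_divide_eq_right)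
    next
      case True
      then have "{0..z} = {}" by (auto simp: z_def)
      then show ?thesis using True by simp
    qed
    finally show ?thesis by (simp add: z_def)
  qed
  \<comment> \<open>Distribution functions determine finite measures. Both measures are carried by
    \<open>{..1}\<close>, whose mass is given by the formulas just proved.\<close>
  have fin: "finite_measure ?D"
  proof
    have "AE x in ?D. x \<le> 1"
      using t2 by (subst AE_distr_iff) (auto simp: divide_le_eq sum_nonneg add_pos_nonneg)
    then have "emeasure ?D (space ?D) = emeasure ?D {..1}"
      by (intro emeasure_eq_AE) auto
    also have "\<dots> \<noteq> \<infinity>" unfolding D by simp
    finally show "emeasure ?D (space ?D) \<noteq> \<infinity>" .
  qed
  have fin2: "finite_measure ?E"
  proof
    have "AE x in ?E. x \<le> 1"
      by (subst AE_density) (auto intro!: AE_I2 split: split_indicator_asm intro: order_trans[of _ "1 - t\<^sup>2"])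
    then have "emeasure ?E (space ?E) = emeasure ?E {..1}"
      by (intro emeasure_eq_AE) auto
    also have "\<dots> \<noteq> \<infinity>" unfolding E by simp
    finally show "emeasure ?E (space ?E) \<noteq> \<infinity>" .
  qed
  have "cdf ?D = cdf ?E"
    unfolding cdf_def measure_def D E ..
  then show ?thesis
    using fin fin2 by (intro cdf_unique')
      (simp_all add: finite_borel_measure_def finite_borel_measure_axioms_def)
qed


text \<open>The half ball is sliced at height t along \<open>e\<close>, and each slice is pushed to
  the squared sine a of the angle with \<open>e\<close>. Exchanging the two integrals leaves the
  integral of \<open>t ^ m\<close> up to \<open>sqrt (1 - a)\<close>, which turns the exponent of
  \<open>1 - a\<close> into \<open>- 1 / 2\<close>. The substitution \<open>b = 1 - a\<close> then
  shows the unnormalised Beta density with parameters 1/2 and m/2 of the squared cosine.\<close>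

lemma nn_integral_half_ball:
  fixes e :: "'a::euclidean_space" and g :: "real \<Rightarrow> ennreal"
  assumes e: "e \<in> Basis" and dim: "DIM('a) \<ge> 2" and g[measurable]: "g \<in> borel_measurable borel"
  defines "m \<equiv> DIM('a) - 1"
  shows "(\<integral>\<^sup>+x. indicator (cball 0 1) x * (indicator {0<..} (x \<bullet> e) * g ((x \<bullet> e)\<^sup>2 / (norm x)\<^sup>2)) \<partial>lborel)
    = ennreal (unit_ball_vol m * m / 2 / Suc m) *
      (\<integral>\<^sup>+b. indicator {0<..<1} b * ennreal (b powr (- 1 / 2) * (1 - b) powr (real m / 2 - 1)) * g b \<partial>lborel)"
    (is "?L = _")
proof -
  interpret product_sigma_finite "\<lambda>_::'a. lborel :: real measure" ..
  define A where "A = (Basis - {e} :: 'a set)"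
  have A: "finite A" "e \<notin> A" "Basis = insert e A" "card A = m"
    using e by (auto simp: A_def m_def)
  have m: "m > 0" using dim by (simp add: m_def)
  then have A0: "A \<noteq> {}" using A by auto
  define M where "M = Pi\<^sub>M A (\<lambda>_. lborel :: real measure)"
  define s where "s = (\<lambda>y::'a \<Rightarrow> real. \<Sum>i\<in>A. (y i)\<^sup>2)"
  have s0: "s y \<ge> 0" for y by (simp add: s_def sum_nonneg)
  have [measurable]: "s \<in> borel_measurable M"
    unfolding M_def s_def by measurable
  define h where "h = (\<lambda>a. a powr (real m/2 - 1) * (1 - a) powr (- real m/2 - 1))"
  have [measurable]: "h \<in> borel_measurable borel" unfolding h_def by measurable
  have h0: "h a \<ge> 0" for a by (simp add: h_def)
  define c where "c = unit_ball_vol m * m / 2"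
  have c0: "c \<ge> 0" by (simp add: c_def)
  \<comment> \<open>\<open>x\<close> assembles a vector from its coordinates and carries the product
    of one-dimensional Lebesgue measures to \<open>lborel\<close>, so the coordinate along
    \<open>e\<close> can be split off.\<close>
  define x where "x = (\<lambda>f. \<Sum>b\<in>Basis. f b *\<^sub>R (b::'a))"
  have xe: "x (y(e := t)) \<bullet> e = t" and xn: "(norm (x (y(e := t))))\<^sup>2 = t\<^sup>2 + s y" for y t
  proof -
    have xb: "x f \<bullet> b = f b" if "b \<in> Basis" for f b
      using that by (simp add: x_def)
    show "x (y(e := t)) \<bullet> e = t" using xb[OF e] by simp
    have "(norm (x (y(e := t))))\<^sup>2 = (\<Sum>b\<in>Basis. ((y(e := t)) b)\<^sup>2)"
      unfolding power2_norm_eq_inner by (subst euclidean_inner) (simp add: xb power2_eq_square)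
    also have "\<dots> = t\<^sup>2 + s y"
      unfolding A(3) s_def using A(1,2) by (auto intro!: sum.cong)
    finally show "(norm (x (y(e := t))))\<^sup>2 = t\<^sup>2 + s y" .
  qed
  have [measurable]: "x \<in> Pi\<^sub>M Basis (\<lambda>_. lborel) \<rightarrow>\<^sub>M borel"
    unfolding x_def by measurable
  have lborel_x: "(lborel :: 'a measure) = distr (Pi\<^sub>M Basis (\<lambda>_. lborel)) borel x"
    unfolding x_def by (rule lborel_eq)
  have [measurable]: "cball (0::'a) 1 \<in> sets borel" by simp
  have "?L = (\<integral>\<^sup>+f. indicator (cball 0 1) (x f) * (indicator {0<..} (x f \<bullet> e) *
      g ((x f \<bullet> e)\<^sup>2 / (norm (x f))\<^sup>2)) \<partial>Pi\<^sub>M Basis (\<lambda>_. lborel))"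
    unfolding lborel_x by (rule nn_integral_distr) measurable
  also have "\<dots> = (\<integral>\<^sup>+t. (\<integral>\<^sup>+y. indicator (cball 0 1) (x (y(e := t))) * (indicator {0<..} (x (y(e := t)) \<bullet> e) *
      g ((x (y(e := t)) \<bullet> e)\<^sup>2 / (norm (x (y(e := t))))\<^sup>2)) \<partial>M) \<partial>lborel)"
    unfolding M_def A(3) by (rule product_nn_integral_insert_rev) (use A in \<open>auto simp flip: A(3)\<close>)
  also have "\<dots> = (\<integral>\<^sup>+t. (\<integral>\<^sup>+y. indicator {..1} (t\<^sup>2 + s y) * (indicator {0<..} t * g (t\<^sup>2 / (t\<^sup>2 + s y))) \<partial>M) \<partial>lborel)"
  proof (intro nn_integral_cong)
    fix t y
    have "norm (x (y(e := t))) \<le> 1 \<longleftrightarrow> t\<^sup>2 + s y \<le> 1"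
      unfolding xn[symmetric] by (simp add: power_le_one_iff abs_square_le_1)
    then show "indicator (cball 0 1) (x (y(e := t))) * (indicator {0<..} (x (y(e := t)) \<bullet> e) *
      g ((x (y(e := t)) \<bullet> e)\<^sup>2 / (norm (x (y(e := t))))\<^sup>2)) =
      indicator {..1} (t\<^sup>2 + s y) * (indicator {0<..} t * g (t\<^sup>2 / (t\<^sup>2 + s y)))"
      unfolding xe xn by (auto split: split_indicator)
  qed
  also have "\<dots> = (\<integral>\<^sup>+t. (\<integral>\<^sup>+a. indicator {0..} t * ennreal (c * t ^ m) *
      (indicator {0..1 - t\<^sup>2} a * ennreal (h a) * g (1 - a)) \<partial>lborel) \<partial>lborel)"
  proof (rule nn_integral_cong_AE)
    \<comment> \<open>The fibre law requires \<open>0 < t\<close> and \<open>t < 1\<close>. The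
      heights 0 and 1 form a null set, and for the remaining heights both sides vanish.\<close>
    have "AE t in lborel. t \<noteq> (0::real)" "AE t in lborel. t \<noteq> (1::real)"
      by (auto intro: AE_lborel_singleton)
    then show "AE t in lborel. (\<integral>\<^sup>+y. indicator {..1} (t\<^sup>2 + s y) * (indicator {0<..} t * g (t\<^sup>2 / (t\<^sup>2 + s y))) \<partial>M) =
        (\<integral>\<^sup>+a. indicator {0..} t * ennreal (c * t ^ m) *
      (indicator {0..1 - t\<^sup>2} a * ennreal (h a) * g (1 - a)) \<partial>lborel)"
    proof eventually_elim
      case (elim t)
      consider "t < 0" | "t > 1" | "0 < t" "t < 1" using elim by linarith
      then show ?case
      proof cases
        case 2
        then have "t\<^sup>2 > 1" by (simp add: one_less_power)
        then have "{0..1 - t\<^sup>2} = {}" "indicator {..1} (t\<^sup>2 + s y) = (0::ennreal)" for y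
          using s0[of y] by auto
        then show ?thesis by simp
      next
        case 3
        have "(\<integral>\<^sup>+y. indicator {..1} (t\<^sup>2 + s y) * (indicator {0<..} t * g (t\<^sup>2 / (t\<^sup>2 + s y))) \<partial>M)
            = (\<integral>\<^sup>+y. indicator {..1 - t\<^sup>2} (s y) * g (1 - s y / (t\<^sup>2 + s y)) \<partial>M)"
        proof (intro nn_integral_cong)
          fix y
          have "t\<^sup>2 + s y \<noteq> 0" using 3 s0[of y] by (smt (verit) zero_less_power)
          then have "t\<^sup>2 / (t\<^sup>2 + s y) = 1 - s y / (t\<^sup>2 + s y)" by (simp add: field_simps)
          then show "indicator {..1} (t\<^sup>2 + s y) * (indicator {0<..} t * g (t\<^sup>2 / (t\<^sup>2 + s y))) =
              indicator {..1 - t\<^sup>2} (s y) * g (1 - s y / (t\<^sup>2 + s y))"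
            using 3 by (auto split: split_indicator)
        qed
        also have "\<dots> = (\<integral>\<^sup>+y. g (1 - s y / (t\<^sup>2 + s y)) \<partial>density M (\<lambda>y. indicator {..1 - t\<^sup>2} (s y)))"
          by (subst nn_integral_density) auto
        also have "\<dots> = (\<integral>\<^sup>+a. g (1 - a) \<partial>distr (density M (\<lambda>y. indicator {..1 - t\<^sup>2} (s y))) borel
            (\<lambda>y. s y / (t\<^sup>2 + s y)))"
          by (subst nn_integral_distr) auto
        also have "\<dots> = (\<integral>\<^sup>+a. g (1 - a) \<partial>density lborel (\<lambda>a. ennreal (c * t ^ m) * (indicator {0..1 - t\<^sup>2} a * ennreal (h a))))"
          using distr_sq_sine_fibre[OF A(1) A0 3] unfolding A(4) s_def M_def c_def h_def by simp
        also have "\<dots> = (\<integral>\<^sup>+a. indicator {0..} t * ennreal (c * t ^ m) *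
            (indicator {0..1 - t\<^sup>2} a * ennreal (h a) * g (1 - a)) \<partial>lborel)"
          using 3 by (subst nn_integral_density) (auto simp: mult_ac)
        finally show ?thesis .
      qed simp
    qed
  qed
  also have "\<dots> = (\<integral>\<^sup>+a. (\<integral>\<^sup>+t. indicator {0..} t * ennreal (c * t ^ m) *
      (indicator {0..1 - t\<^sup>2} a * ennreal (h a) * g (1 - a)) \<partial>lborel) \<partial>lborel)"
    by (rule lborel_pair.Fubini'[symmetric]) (simp add: indicator_def, measurable)
  also have "\<dots> = (\<integral>\<^sup>+a. ennreal (c / Suc m) * (indicator {0<..<1} a *
      ennreal (a powr (real m / 2 - 1) * (1 - a) powr (- 1 / 2)) * g (1 - a)) \<partial>lborel)"
  proof (rule nn_integral_cong_AE)
    have "AE a in lborel. a \<noteq> (0::real)" "AE a in lborel. a \<noteq> (1::real)"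
      by (auto intro: AE_lborel_singleton)
    then show "AE a in lborel. (\<integral>\<^sup>+t. indicator {0..} t * ennreal (c * t ^ m) *
      (indicator {0..1 - t\<^sup>2} a * ennreal (h a) * g (1 - a)) \<partial>lborel) =
      ennreal (c / Suc m) * (indicator {0<..<1} a *
      ennreal (a powr (real m / 2 - 1) * (1 - a) powr (- 1 / 2)) * g (1 - a))"
    proof eventually_elim
      case (elim a)
      show ?case
      proof (cases "0 < a \<and> a < 1")
        case False
        then have "a < 0 \<or> 1 < a" using elim by auto
        then have "a \<notin> {0..1 - t\<^sup>2}" for t
          using zero_le_power2[of t] unfolding atLeastAtMost_iff by linarith
        then show ?thesis using False by auto
      next
        case True
        \<comment> \<open>\<open>q\<close> is the largest height at which a point of the ball can
          have squared sine \<open>a\<close>.\<close>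
        define q where "q = sqrt (1 - a)"
        have q: "q \<ge> 0" "q\<^sup>2 = 1 - a" using True by (auto simp: q_def)
        have "(\<integral>\<^sup>+t. indicator {0..} t * ennreal (c * t ^ m) *
            (indicator {0..1 - t\<^sup>2} a * ennreal (h a) * g (1 - a)) \<partial>lborel)
          = (\<integral>\<^sup>+t. (ennreal c * ennreal (h a) * g (1 - a)) * (indicator {0..q} t * ennreal (t ^ m)) \<partial>lborel)"
        proof (intro nn_integral_cong)
          fix t :: real
          have "a \<le> 1 - t\<^sup>2 \<longleftrightarrow> t \<le> q" if "t \<ge> 0"
            using q that by (smt (verit) power2_le_imp_le power_mono)
          then show "indicator {0..} t * ennreal (c * t ^ m) * (indicator {0..1 - t\<^sup>2} a * ennreal (h a) * g (1 - a))
             = (ennreal c * ennreal (h a) * g (1 - a)) * (indicator {0..q} t * ennreal (t ^ m))"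
            using True c0 by (auto split: split_indicator simp: ennreal_mult mult_ac)
        qed
        also have "\<dots> = ennreal c * ennreal (h a) * g (1 - a) * ennreal (q ^ Suc m / Suc m)"
          using nn_integral_power_Icc[OF q(1)] by (subst nn_integral_cmult) auto
        also have "\<dots> = ennreal (c / Suc m) * ennreal (h a * q ^ Suc m) * g (1 - a)"
        proof -
          have "ennreal c * ennreal (h a) * ennreal (q ^ Suc m / Suc m) = ennreal (c / Suc m) * ennreal (h a * q ^ Suc m)"
            using c0 h0[of a] q(1) by (simp add: ennreal_mult[symmetric] mult_ac del: power_Suc)
          then show ?thesis by (metis mult.assoc mult.commute)
        qed
        also have "h a * q ^ Suc m = a powr (real m / 2 - 1) * (1 - a) powr (- 1 / 2)"
        proof -
          have "q ^ Suc m = (1 - a) powr (real (Suc m) / 2)"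
            using True by (simp add: q_def powr_half_sqrt[symmetric] powr_realpow[symmetric] powr_powr
              del: power_Suc of_nat_Suc)
          moreover have "(1 - a) powr (- real m/2 - 1) * (1 - a) powr (real (Suc m) / 2) = (1 - a) powr (- 1 / 2)"
            by (simp only: powr_add[symmetric]) (rule arg_cong[where f = "(powr) (1 - a)"], simp add: field_simps)
          ultimately show ?thesis unfolding h_def by (simp only: mult.assoc)
        qed
        finally show ?thesis using True by (simp add: mult_ac)
      qed
    qed
  qed
  also have "\<dots> = ennreal (c / Suc m) * (\<integral>\<^sup>+a. indicator {0<..<1} a *
      ennreal (a powr (real m / 2 - 1) * (1 - a) powr (- 1 / 2)) * g (1 - a) \<partial>lborel)"
    by (rule nn_integral_cmult) measurable
  also have "(\<integral>\<^sup>+a. indicator {0<..<1} a *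
      ennreal (a powr (real m / 2 - 1) * (1 - a) powr (- 1 / 2)) * g (1 - a) \<partial>lborel)
    = (\<integral>\<^sup>+b. indicator {0<..<1} b * ennreal (b powr (- 1 / 2) * (1 - b) powr (real m / 2 - 1)) * g b \<partial>lborel)"
    by (subst nn_integral_lborel_reflect[of _ 1, symmetric])
      (auto intro!: nn_integral_cong simp: mult_ac split: split_indicator)
  finally show ?thesis unfolding c_def .
qed

lemma prob_space_beta_distribution:
  assumes p: "p > 0" and q: "q > 0"
  shows "prob_space (beta_distribution p q)"
proof
  have B: "Beta p q > 0" using p q by (simp add: Beta_def Gamma_real_pos)
  have [measurable]: "beta_density p q \<in> borel_measurable borel"
    unfolding beta_density_def by measurable
  have "emeasure (beta_distribution p q) (space (beta_distribution p q)) = (\<integral>\<^sup>+x. ennreal (beta_density p q x) \<partial>lborel)"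
    by (simp add: beta_distribution_def emeasure_density)
  also have "\<dots> = (\<integral>\<^sup>+x. indicator {0..1} x * ennreal (x powr (p - 1) * (1 - x) powr (q - 1)) / ennreal (Beta p q) \<partial>lborel)"
  proof (rule nn_integral_cong_AE)
    have "AE x in lborel. x \<noteq> (0::real)" "AE x in lborel. x \<noteq> (1::real)"
      by (auto intro: AE_lborel_singleton)
    then show "AE x in lborel. ennreal (beta_density p q x) =
        indicator {0..1} x * ennreal (x powr (p - 1) * (1 - x) powr (q - 1)) / ennreal (Beta p q)"
      by eventually_elim (use B in \<open>auto simp: beta_density_def divide_ennreal split: split_indicator\<close>)
  qed
  also have "\<dots> = (\<integral>\<^sup>+x. indicator {0..1} x * ennreal (x powr (p - 1) * (1 - x) powr (q - 1)) \<partial>lborel) / ennreal (Beta p q)"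
    by (rule nn_integral_divide) measurable
  also have "(\<integral>\<^sup>+x. indicator {0..1} x * ennreal (x powr (p - 1) * (1 - x) powr (q - 1)) \<partial>lborel) = ennreal (Beta p q)"
    using nn_integral_has_integral_lebesgue[OF _ has_integral_Beta_real[OF p q]]
    by (simp add: ennreal_mult' ennreal_indicator)
  also have "ennreal (Beta p q) / ennreal (Beta p q) = 1"
    using B by (simp add: divide_ennreal)
  finally show "emeasure (beta_distribution p q) (space (beta_distribution p q)) = 1" .
qed

section \<open>From the ball to the sphere: coordinates of a uniform direction\<close>

lemma sets_uniform_sphere [simp, measurable_cong]: "sets uniform_sphere = sets borel"
  by (simp add: uniform_sphere_def)

lemma space_uniform_sphere [simp]: "space uniform_sphere = UNIV"
  by (simp add: uniform_sphere_def)

text \<open>The integral is taken over the closed ball to match the closed slices of the half-ball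
  computation. Open and closed ball differ by the sphere, a null set.\<close>

lemma nn_integral_uniform_sphere:
  fixes f :: "'a::euclidean_space \<Rightarrow> ennreal"
  assumes [measurable]: "f \<in> borel_measurable borel"
  shows "(\<integral>\<^sup>+v. f v \<partial>uniform_sphere) =
    (\<integral>\<^sup>+x. indicator (cball 0 1) x * f (x /\<^sub>R norm x) \<partial>lborel) / emeasure lborel (ball (0::'a) 1)"
proof -
  have "(\<integral>\<^sup>+v. f v \<partial>uniform_sphere) = (\<integral>\<^sup>+x. f (x /\<^sub>R norm x) * indicator (ball 0 1) x \<partial>lborel) / emeasure lborel (ball (0::'a) 1)"
    unfolding uniform_sphere_def
    by (subst nn_integral_distr) (simp_all add: nn_integral_uniform_measure)
  moreover have "(\<integral>\<^sup>+x. f (x /\<^sub>R norm x) * indicator (ball 0 1) x \<partial>lborel)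
      = (\<integral>\<^sup>+x. indicator (cball 0 1) x * f (x /\<^sub>R norm x) \<partial>lborel)"
  proof (rule nn_integral_cong_AE)
    have "sphere (0::'a) 1 \<in> null_sets lborel"
      using negligible_sphere[of "0::'a" 1]
      by (auto simp: null_sets_completion_iff negligible_iff_null_sets)
    then have "AE x::'a in lborel. x \<notin> sphere 0 1" by (rule AE_not_in)
    then show "AE x in lborel. f (x /\<^sub>R norm x) * indicator (ball 0 1) x =
        indicator (cball 0 1) x * f (x /\<^sub>R norm x)"
      by eventually_elim (auto split: split_indicator)
  qed
  ultimately show ?thesis by simp
qed

text \<open>An orthogonal transformation carries \<open>u'\<close> to \<open>u\<close>, and the
  uniform law is invariant under it. This allows any axis to be replaced by a basis vector, and
  gives all points of the configuration the same tail.\<close>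

lemma distr_uniform_sphere_inner:
  fixes u u' :: "real ^ 'n"
  assumes "norm u = norm u'"
  shows "distr uniform_sphere borel (\<lambda>v. v \<bullet> u) = distr uniform_sphere borel (\<lambda>v. v \<bullet> u')"
proof -
  obtain T where T: "orthogonal_transformation T" "T u' = u"
    using orthogonal_transformation_exists[of u' u] assms by auto
  have [measurable]: "T \<in> borel_measurable borel"
    using orthogonal_transformation_linear[OF T(1)]
    by (intro borel_measurable_continuous_onI linear_continuous_on)
      (simp add: linear_conv_bounded_linear)
  have "distr uniform_sphere borel (\<lambda>v. v \<bullet> u) = distr (distr uniform_sphere borel T) borel (\<lambda>v. v \<bullet> u)"
    using orthogonal_invariant_uniform_sphere[OF T(1)] by simp
  also have "\<dots> = distr uniform_sphere borel (\<lambda>v. v \<bullet> u')"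
    using T by (subst distr_distr) (simp_all add: comp_def orthogonal_transformation_def flip: T(2))
  finally show ?thesis .
qed

text \<open>By rotation invariance the axis may be a basis vector \<open>e\<close>. The direction of
  a point x of the ball has squared coordinate
  \<open>(x \<bullet> e)\<^sup>2 / (norm x)\<^sup>2\<close>, which is the quantity in the half-ball
  integral.\<close>

lemma nn_integral_uniform_sphere_half:
  fixes u :: "real ^ 'n" and g :: "real \<Rightarrow> ennreal"
  assumes u: "norm u = 1" and n: "CARD('n) \<ge> 2" and [measurable]: "g \<in> borel_measurable borel"
  defines "m \<equiv> CARD('n) - 1"
  shows "(\<integral>\<^sup>+v. indicator {0<..} (v \<bullet> u) * g ((v \<bullet> u)\<^sup>2) \<partial>uniform_sphere) =
    ennreal (unit_ball_vol m * m / 2 / Suc m) / emeasure lborel (ball (0::real ^ 'n) 1) *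
    (\<integral>\<^sup>+b. indicator {0<..<1} b * ennreal (b powr (- 1 / 2) * (1 - b) powr (real m / 2 - 1)) * g b \<partial>lborel)"
proof -
  obtain e :: "real ^ 'n" where e: "e \<in> Basis" using nonempty_Basis by blast
  have law: "distr uniform_sphere borel (\<lambda>v. v \<bullet> u) = distr uniform_sphere borel (\<lambda>v. v \<bullet> e)"
    using e u by (intro distr_uniform_sphere_inner) simp
  have inner: "(\<integral>\<^sup>+v. indicator {0<..} (v \<bullet> w) * g ((v \<bullet> w)\<^sup>2) \<partial>uniform_sphere)
      = (\<integral>\<^sup>+t. indicator {0<..} t * g (t\<^sup>2) \<partial>distr uniform_sphere borel (\<lambda>v. v \<bullet> w))" for w :: "real ^ 'n"
    by (subst nn_integral_distr) simp_all
  have "(\<integral>\<^sup>+v. indicator {0<..} (v \<bullet> u) * g ((v \<bullet> u)\<^sup>2) \<partial>uniform_sphere)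
      = (\<integral>\<^sup>+v. indicator {0<..} (v \<bullet> e) * g ((v \<bullet> e)\<^sup>2) \<partial>uniform_sphere)"
    unfolding inner law ..
  also have "\<dots> = (\<integral>\<^sup>+x. indicator (cball 0 1) x * (indicator {0<..} (x \<bullet> e) * g ((x \<bullet> e)\<^sup>2 / (norm x)\<^sup>2)) \<partial>lborel)
      / emeasure lborel (ball (0::real ^ 'n) 1)"
    by (subst nn_integral_uniform_sphere)
      (auto intro!: arg_cong2[where f = "(/)"] nn_integral_cong
        simp: power_divide power_mult_distrib field_simps zero_less_mult_iff zero_less_divide_iff split: split_indicator)
  also have "\<dots> = ennreal (unit_ball_vol m * m / 2 / Suc m) / emeasure lborel (ball (0::real ^ 'n) 1) *
    (\<integral>\<^sup>+b. indicator {0<..<1} b * ennreal (b powr (- 1 / 2) * (1 - b) powr (real m / 2 - 1)) * g b \<partial>lborel)"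
    using n unfolding m_def
    by (subst nn_integral_half_ball[OF e]) (simp_all add: divide_ennreal_def mult_ac)
  finally show ?thesis .
qed

text \<open>The squared coordinate has a density proportional to that of the Beta law with
  parameters 1/2 and \<open>(n - 1) / 2\<close>. The weight \<open>b powr \<gamma>\<close> raises
  the first parameter to \<open>\<gamma> + 1 / 2\<close>. Hence the cap moment and the half-space
  moment are the same constant \<open>C\<close> times the Beta mass above \<open>k\<^sup>2\<close>
  and above 0, and \<open>C\<close> never has to be evaluated.\<close>

lemma uniform_sphere_cap_moment:
  fixes u :: "real ^ 'n"
  assumes u: "norm u = 1" and n: "CARD('n) \<ge> 2" and \<gamma>: "\<gamma> > 0" and k: "k \<ge> 0"
  shows "(\<integral>v. indicator {v. k < v \<bullet> u} v * (v \<bullet> u) powr (2 * \<gamma>) \<partial>uniform_sphere) =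
    (1 - measure (beta_distribution (\<gamma> + 1 / 2) ((real CARD('n) - 1) / 2)) {x. x < k\<^sup>2}) *
    (\<integral>v. indicator {v. 0 < v \<bullet> u} v * (v \<bullet> u) powr (2 * \<gamma>) \<partial>uniform_sphere)"
proof -
  define m where "m = CARD('n) - 1"
  define p q where "p = \<gamma> + 1 / 2" and "q = (real CARD('n) - 1) / 2"
  have q_m: "q = real m / 2" using n by (simp add: q_def m_def of_nat_diff)
  have pq: "p > 0" "q > 0" using n \<gamma> by (auto simp: p_def q_def)
  define \<beta> where "\<beta> = beta_distribution p q"
  interpret \<beta>: prob_space \<beta> unfolding \<beta>_def using pq by (rule prob_space_beta_distribution)
  interpret S: prob_space "uniform_sphere :: (real ^ 'n) measure" by (rule prob_space_uniform_sphere)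
  have [simp]: "sets \<beta> = sets borel" "space \<beta> = UNIV" by (simp_all add: \<beta>_def beta_distribution_def)
  have B: "Beta p q > 0" using pq by (simp add: Beta_def Gamma_real_pos)
  define C where "C = ennreal (unit_ball_vol m * m / 2 / Suc m) / emeasure lborel (ball (0::real ^ 'n) 1) * ennreal (Beta p q)"
  have [measurable]: "beta_density p q \<in> borel_measurable borel"
    unfolding beta_density_def by measurable
  define J where "J = (\<lambda>k. \<integral>\<^sup>+v. ennreal (indicator {v. k < v \<bullet> u} v * (v \<bullet> u) powr (2 * \<gamma>)) \<partial>uniform_sphere)"
  have J: "J k = C * emeasure \<beta> {k\<^sup>2<..}" if k: "k \<ge> 0" for k
  proof -
    have "J k = (\<integral>\<^sup>+v. indicator {0<..} (v \<bullet> u) * (indicator {k\<^sup>2<..} ((v \<bullet> u)\<^sup>2) * ennreal (((v \<bullet> u)\<^sup>2) powr \<gamma>)) \<partial>uniform_sphere)"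
      unfolding J_def
    proof (intro nn_integral_cong)
      fix v
      have "k < v \<bullet> u \<longleftrightarrow> 0 < v \<bullet> u \<and> k\<^sup>2 < (v \<bullet> u)\<^sup>2"
        using k by (smt (verit) power_less_imp_less_base power_strict_mono zero_less_numeral)
      moreover have "(v \<bullet> u) powr (2 * \<gamma>) = ((v \<bullet> u)\<^sup>2) powr \<gamma>" if "0 < v \<bullet> u"
        using that by (simp add: powr_powr[symmetric] powr_numeral)
      ultimately show "ennreal (indicator {v. k < v \<bullet> u} v * (v \<bullet> u) powr (2 * \<gamma>)) =
          indicator {0<..} (v \<bullet> u) * (indicator {k\<^sup>2<..} ((v \<bullet> u)\<^sup>2) * ennreal (((v \<bullet> u)\<^sup>2) powr \<gamma>))"
        by (auto split: split_indicator)
    qed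
    also have "\<dots> = ennreal (unit_ball_vol m * m / 2 / Suc m) / emeasure lborel (ball (0::real ^ 'n) 1) *
      (\<integral>\<^sup>+b. indicator {0<..<1} b * ennreal (b powr (- 1 / 2) * (1 - b) powr (real m / 2 - 1)) *
        (indicator {k\<^sup>2<..} b * ennreal (b powr \<gamma>)) \<partial>lborel)"
      unfolding m_def by (rule nn_integral_uniform_sphere_half[OF u n]) measurable
    also have "(\<integral>\<^sup>+b. indicator {0<..<1} b * ennreal (b powr (- 1 / 2) * (1 - b) powr (real m / 2 - 1)) *
        (indicator {k\<^sup>2<..} b * ennreal (b powr \<gamma>)) \<partial>lborel)
      = (\<integral>\<^sup>+b. ennreal (Beta p q) * (ennreal (beta_density p q b) * indicator {k\<^sup>2<..} b) \<partial>lborel)"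
    proof (intro nn_integral_cong)
      fix b
      have "b powr (- 1 / 2) * (1 - b) powr (real m / 2 - 1) * b powr \<gamma> =
        Beta p q * beta_density p q b" if "0 < b" "b < 1"
      proof -
        have "b powr (- 1 / 2) * b powr \<gamma> = b powr (p - 1)"
          unfolding powr_add[symmetric] p_def by (rule arg_cong[where f = "(powr) b"]) simp
        then show ?thesis using B that by (simp add: beta_density_def q_m mult_ac)
      qed
      then show "indicator {0<..<1} b * ennreal (b powr (- 1 / 2) * (1 - b) powr (real m / 2 - 1)) *
        (indicator {k\<^sup>2<..} b * ennreal (b powr \<gamma>))
        = ennreal (Beta p q) * (ennreal (beta_density p q b) * indicator {k\<^sup>2<..} b)"
        using B by (auto split: split_indicator simp: ennreal_mult'[symmetric] ennreal_mult''[symmetric] beta_density_def)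
    qed
    also have "\<dots> = ennreal (Beta p q) * emeasure \<beta> {k\<^sup>2<..}"
      unfolding \<beta>_def beta_distribution_def
      by (subst nn_integral_cmult) (auto simp: emeasure_density)
    finally show ?thesis by (simp add: C_def mult_ac)
  qed
  \<comment> \<open>At threshold 0 the Beta factor is 1, so \<open>C\<close> is the half-space
    moment itself.\<close>
  have AE_pos: "AE x in \<beta>. x > 0" unfolding \<beta>_def beta_distribution_def
    by (subst AE_density) (auto simp: beta_density_def)
  have "emeasure \<beta> {0\<^sup>2<..} = 1"
    using AE_pos by (intro \<beta>.emeasure_eq_1_AE) auto
  then have J0: "J 0 = C" using J[of 0] by simp
  \<comment> \<open>The Beta law has no atom, so the mass above \<open>k\<^sup>2\<close> is the
    complement of the strict event \<open>x < k\<^sup>2\<close> that defines \<Delta>.\<close>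
  have "AE x in \<beta>. x \<noteq> k\<^sup>2" unfolding \<beta>_def beta_distribution_def
    using AE_lborel_singleton[of "k\<^sup>2"] by (subst AE_density) (auto elim: eventually_mono)
  then have "measure \<beta> {k\<^sup>2<..} = measure \<beta> (space \<beta> - {x. x < k\<^sup>2})"
    by (intro \<beta>.finite_measure_eq_AE) (auto elim!: eventually_mono)
  also have "\<dots> = 1 - measure \<beta> {x. x < k\<^sup>2}"
    by (rule \<beta>.prob_compl) simp
  finally have Jk: "J k = J 0 * ennreal (1 - measure \<beta> {x. x < k\<^sup>2})"
    using J[OF k] by (simp add: J0 \<beta>.emeasure_eq_measure)
  have eq: "(\<integral>v. indicator {v. k < v \<bullet> u} v * (v \<bullet> u) powr (2 * \<gamma>) \<partial>uniform_sphere) = enn2real (J k)" for k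
    unfolding J_def by (subst integral_eq_nn_integral) auto
  show ?thesis
    unfolding eq Jk enn2real_mult p_def[symmetric] q_def[symmetric] \<beta>_def[symmetric]
    using \<beta>.prob_le_1[of "{x. x < k\<^sup>2}"] by simp
qed

section \<open>Caps of critical radius\<close>

text \<open>The points of the unit ball with direction in \<open>U\<close> contain
  \<open>z /\<^sub>R 2\<close>. With the origin removed, where the direction map is not continuous,
  they form an open set, so they have positive volume.\<close>

lemma emeasure_uniform_sphere_open_pos:
  fixes z :: "'a::euclidean_space"
  assumes U: "open U" and z: "z \<in> U" "norm z = 1"
  shows "emeasure uniform_sphere U > 0"
proof -
  define g where "g = (\<lambda>x::'a. x /\<^sub>R norm x)"
  define V where "V = ball 0 1 \<inter> {x \<in> - {0}. g x \<in> U}"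
  have "continuous_on (- {0}) g" unfolding g_def by (intro continuous_intros) auto
  then have "open {x \<in> - {0}. g x \<in> U}"
    using continuous_open_preimage[of "- {0}" g U] U by (auto simp: vimage_def Int_def)
  then have V: "open V" unfolding V_def by (intro open_Int) auto
  moreover have "z /\<^sub>R 2 \<in> V" using z by (auto simp: V_def g_def)
  ultimately have "\<not> negligible V" using open_not_negligible by blast
  then have 1: "emeasure lborel V \<noteq> 0"
    using V by (auto simp: negligible_iff_null_sets null_sets_completion_iff null_sets_def)
  have [measurable]: "g \<in> borel_measurable borel" unfolding g_def by simp
  have "emeasure uniform_sphere U = emeasure lborel (ball 0 1 \<inter> g -` U) / emeasure lborel (ball (0::'a) 1)"
    using U measurable_sets[of g borel borel U]
    by (simp add: uniform_sphere_def g_def[symmetric] emeasure_distr)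
  moreover have "emeasure lborel V \<le> emeasure lborel (ball 0 1 \<inter> g -` U)"
    using U measurable_sets[of g borel borel U] by (intro emeasure_mono) (auto simp: V_def)
  ultimately show ?thesis
    using 1 emeasure_ball_01[where 'a='a]
    by (auto simp: ennreal_zero_less_divide zero_less_iff_neq_zero less_top)
qed

section \<open>Two caps: separation and contact\<close>

lemma norm_add_le_of_inner_le:
  fixes x y :: "'a::real_inner"
  assumes "norm x = 1" "norm y = 1" "x \<bullet> y \<le> 2 * k\<^sup>2 - 1" "k \<ge> 0"
  shows "norm (x + y) \<le> 2 * k"
proof (rule power2_le_imp_le)
  \<comment> \<open>If \<open>k\<close> is the cosine of the cap radius,
    \<open>2 * k\<^sup>2 - 1\<close> is the cosine of twice that radius. The bound follows from
    \<open>(norm (x + y))\<^sup>2 = 2 + 2 * (x \<bullet> y)\<close>.\<close>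
  show "(norm (x + y))\<^sup>2 \<le> (2 * k)\<^sup>2"
    using assms unfolding power2_norm_eq_inner
    by (simp add: inner_add_left inner_add_right inner_commute norm_eq_1)
qed (use assms in simp)

text \<open>By Cauchy-Schwarz, \<open>x \<bullet> p + y \<bullet> p\<close> is at most
  \<open>norm (x + y)\<close>, hence at most \<open>2 * k\<close>, so the two terms cannot both
  reach \<open>k\<close> when one exceeds it.\<close>

lemma caps_disjoint:
  fixes x y p :: "'a::real_inner"
  assumes "norm x = 1" "norm y = 1" "norm p = 1" "x \<bullet> y \<le> 2 * k\<^sup>2 - 1" "k \<ge> 0" "k < x \<bullet> p"
  shows "y \<bullet> p < k"
proof -
  have "(x + y) \<bullet> p \<le> 2 * k"
    using norm_cauchy_schwarz[of "x + y" p] norm_add_le_of_inner_le[of x y k] assms by simp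
  then show ?thesis using assms by (simp add: inner_add_left)
qed

text \<open>This is the equality case of the Cauchy-Schwarz bound: expanding the square of
  \<open>norm (x + y - (2 * k) *\<^sub>R p)\<close> gives at most
  \<open>4 * k\<^sup>2 - 8 * k\<^sup>2 + 4 * k\<^sup>2 = 0\<close>. For \<open>k > 0\<close> two
  closed caps thus touch in at most one point.\<close>

lemma caps_contact_point:
  fixes x y p :: "'a::real_inner"
  assumes "norm x = 1" "norm y = 1" "norm p = 1" "x \<bullet> y \<le> 2 * k\<^sup>2 - 1" "k \<ge> 0" "k = x \<bullet> p" "k \<le> y \<bullet> p"
  shows "x + y = (2 * k) *\<^sub>R p"
proof -
  have "(norm (x + y - (2 * k) *\<^sub>R p))\<^sup>2 = (norm (x + y))\<^sup>2 - 4 * k * ((x + y) \<bullet> p) + 4 * k\<^sup>2 * (norm p)\<^sup>2"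
    unfolding power2_norm_eq_inner
    by (simp add: inner_simps inner_commute power2_eq_square algebra_simps)
  moreover have "(norm (x + y))\<^sup>2 \<le> 4 * k\<^sup>2"
    using power_mono[OF norm_add_le_of_inner_le[of x y k], of 2] assms by simp
  moreover have "4 * k * (2 * k) \<le> 4 * k * ((x + y) \<bullet> p)"
    using assms by (intro mult_left_mono) (auto simp: inner_add_left)
  ultimately have "(norm (x + y - (2 * k) *\<^sub>R p))\<^sup>2 \<le> 0" using assms by (simp add: power2_eq_square)
  then show ?thesis by simp
qed

text \<open>Moving \<open>p\<close> slightly away from \<open>x\<close> takes it out of the closed
  cap around \<open>x\<close>, while the strict inequalities for the other points survive by
  continuity. The moved point is normalised only at the end, so until then each inner product is
  compared with \<open>k * norm (z \<epsilon>)\<close>.\<close>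

lemma cap_boundary_perturb:
  fixes x p :: "'a::real_inner"
  assumes "finite M" and x: "norm x = 1" and p: "norm p = 1" and k: "0 < k" "k < 1"
    and xp: "x \<bullet> p = k" and free: "\<And>y. y \<in> M \<Longrightarrow> y \<noteq> x \<Longrightarrow> y \<bullet> p < k"
  shows "\<exists>z. norm z = 1 \<and> 0 < x \<bullet> z \<and> (\<forall>y\<in>M. y \<bullet> z < k)"
proof -
  define z where "z = (\<lambda>\<epsilon>. p - \<epsilon> *\<^sub>R x)"
  have "((\<lambda>\<epsilon>. x \<bullet> z \<epsilon>) \<longlongrightarrow> x \<bullet> (p - 0 *\<^sub>R x)) (at_right 0)"
    unfolding z_def by (intro tendsto_intros)
  then have 1: "\<forall>\<^sub>F \<epsilon> in at_right 0. 0 < x \<bullet> z \<epsilon>"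
    using k xp by (auto intro: order_tendstoD)
  have "\<forall>\<^sub>F \<epsilon> in at_right 0. y \<noteq> x \<longrightarrow> y \<bullet> z \<epsilon> - k * norm (z \<epsilon>) < 0" if "y \<in> M" for y
  proof (cases "y = x")
    case False
    have "((\<lambda>\<epsilon>. y \<bullet> z \<epsilon> - k * norm (z \<epsilon>)) \<longlongrightarrow> y \<bullet> (p - 0 *\<^sub>R x) - k * norm (p - 0 *\<^sub>R x)) (at_right 0)"
      unfolding z_def by (intro tendsto_intros)
    then have "\<forall>\<^sub>F \<epsilon> in at_right 0. y \<bullet> z \<epsilon> - k * norm (z \<epsilon>) < 0"
      by (rule order_tendstoD) (use free[OF that False] p in simp)
    then show ?thesis by eventually_elim simp
  qed simp
  then have 2: "\<forall>\<^sub>F \<epsilon> in at_right 0. \<forall>y\<in>M. y \<noteq> x \<longrightarrow> y \<bullet> z \<epsilon> - k * norm (z \<epsilon>) < 0"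
    using \<open>finite M\<close> by (simp add: eventually_ball_finite_distrib)
  have 3: "\<forall>\<^sub>F \<epsilon> in at_right 0. \<epsilon> < k" "\<forall>\<^sub>F \<epsilon> in at_right 0. 0 < (\<epsilon>::real)"
    using k by (auto intro: eventually_at_right_less order_tendstoD)
  obtain \<epsilon> where \<epsilon>: "0 < x \<bullet> z \<epsilon>" "0 < \<epsilon>" "\<epsilon> < k" "\<And>y. y \<in> M \<Longrightarrow> y \<noteq> x \<Longrightarrow> y \<bullet> z \<epsilon> < k * norm (z \<epsilon>)"
    using eventually_happens'[OF _ eventually_conj[OF eventually_conj[OF 1 2] eventually_conj[OF 3]]] by auto
  have "x \<bullet> z \<epsilon> < k * norm (z \<epsilon>)"
  proof (rule power2_less_imp_less)
    have xx: "x \<bullet> x = 1" "p \<bullet> p = 1" "p \<bullet> x = k" using x p xp by (auto simp: norm_eq_1 inner_commute)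
    \<comment> \<open>This product is the factored form of \<open>(k * norm (z \<epsilon>))\<^sup>2
      - (x \<bullet> z \<epsilon>)\<^sup>2\<close>.\<close>
    have "\<epsilon> * (1 - k\<^sup>2) * (2 * k - \<epsilon>) > 0"
      using \<epsilon> k by (intro mult_pos_pos) (auto simp: power_less_one_iff abs_square_less_1)
    then have "(k - \<epsilon>)\<^sup>2 < k\<^sup>2 * (1 - 2 * \<epsilon> * k + \<epsilon>\<^sup>2)"
      by (simp add: power2_eq_square algebra_simps)
    also have "\<dots> = (k * norm (z \<epsilon>))\<^sup>2"
      unfolding power_mult_distrib power2_norm_eq_inner z_def
      by (simp add: inner_simps xx xp power2_eq_square algebra_simps)
    finally show "(x \<bullet> z \<epsilon>)\<^sup>2 < (k * norm (z \<epsilon>))\<^sup>2"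
      by (simp add: z_def inner_simps xx xp)
  qed (use k in simp)
  with \<epsilon> have *: "\<forall>y\<in>M. y \<bullet> z \<epsilon> < k * norm (z \<epsilon>)" by blast
  have "z \<epsilon> \<noteq> 0" using \<epsilon>(1) by auto
  moreover have "y \<bullet> (z \<epsilon> /\<^sub>R norm (z \<epsilon>)) = y \<bullet> z \<epsilon> / norm (z \<epsilon>)" for y
    by (simp add: divide_inverse)
  ultimately show ?thesis
    using \<epsilon>(1) * by (intro exI[of _ "z \<epsilon> /\<^sub>R norm (z \<epsilon>)"]) (simp add: pos_divide_less_eq)
qed

text \<open>From dimension 3 on the boundary of a cap is infinite. Another point \<open>y\<close>
  can reach it only at \<open>(x + y) /\<^sub>R (2 * k)\<close>, so the finitely many points of
  \<open>M\<close> cover only finitely many boundary points.\<close>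

lemma exists_free_cap_boundary_point:
  fixes x :: "'a::euclidean_space"
  assumes M: "finite M" "\<And>y. y \<in> M \<Longrightarrow> norm y = 1" "x \<in> M" and dim: "DIM('a) \<ge> 3" and k: "0 < k" "k < 1"
    and sep: "\<And>y. y \<in> M \<Longrightarrow> y \<noteq> x \<Longrightarrow> x \<bullet> y \<le> 2 * k\<^sup>2 - 1"
  shows "\<exists>p. norm p = 1 \<and> x \<bullet> p = k \<and> (\<forall>y\<in>M. y \<noteq> x \<longrightarrow> y \<bullet> p < k)"
proof (rule ccontr)
  assume contra: "\<not> ?thesis"
  obtain e' where e': "e' \<noteq> 0" "x \<bullet> e' = 0"
    using orthogonal_to_vector_exists[of x] dim by (auto simp: orthogonal_def)
  have "card {x, e'} \<le> 2" by (simp add: card_insert_if)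
  then have "dim {x, e'} < DIM('a)"
    using dim_le_card'[of "{x, e'}"] dim by simp
  then obtain f' where f': "f' \<noteq> 0" "x \<bullet> f' = 0" "e' \<bullet> f' = 0"
    using orthogonal_to_subspace_exists[of "{x, e'}"]
    by (metis insertI1 insertI2 inner_commute orthogonal_def span_base)
  define e f where "e = e' /\<^sub>R norm e'" and "f = f' /\<^sub>R norm f'"
  have ef: "e \<bullet> e = 1" "f \<bullet> f = 1" "e \<bullet> f = 0" "x \<bullet> e = 0" "x \<bullet> f = 0" "x \<bullet> x = 1"
      "e \<bullet> x = 0" "f \<bullet> x = 0" "f \<bullet> e = 0"
  proof -
    have "norm e = 1" "norm f = 1" "norm x = 1" using e' f' M by (auto simp: e_def f_def)
    then show "e \<bullet> e = 1" "f \<bullet> f = 1" "x \<bullet> x = 1" by (simp_all add: norm_eq_1)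
    show "x \<bullet> e = 0" "x \<bullet> f = 0" "e \<bullet> f = 0" using e' f' by (simp_all add: e_def f_def)
    then show "e \<bullet> x = 0" "f \<bullet> x = 0" "f \<bullet> e = 0" by (simp_all add: inner_commute)
  qed
  define s where "s = sqrt (1 - k\<^sup>2)"
  have s: "s\<^sup>2 = 1 - k\<^sup>2" "s > 0"
    using k by (auto simp: s_def power_le_one_iff abs_square_less_1 power_less_one_iff)
  \<comment> \<open>A circle of radius \<open>s\<close> in the boundary of the cap around
    \<open>x\<close>. On \<open>{0..1}\<close>, which lies inside \<open>{0..pi}\<close>, the cosine
    is injective, so this arc is infinite.\<close>
  define p where "p = (\<lambda>t. k *\<^sub>R x + s *\<^sub>R (cos t *\<^sub>R e + sin t *\<^sub>R f))"
  have pe: "p t \<bullet> e = s * cos t" for t by (simp add: p_def inner_simps ef)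
  have "inj_on p {0..1}"
  proof (rule inj_onI)
    fix a b assume "a \<in> {0..1}" "b \<in> {0..1::real}" "p a = p b"
    then show "a = b" using pe[of a] pe[of b] s pi_gt3 by (auto intro: cos_inj_pi)
  qed
  then have inf: "infinite (p ` {0..1})"
    using finite_imageD by (metis infinite_Icc zero_less_one)
  have "p t \<in> (\<lambda>y. (x + y) /\<^sub>R (2 * k)) ` M" for t
  proof -
    have xp: "x \<bullet> p t = k" by (simp add: p_def inner_simps ef)
    have "(k *\<^sub>R x + s *\<^sub>R (a *\<^sub>R e + b *\<^sub>R f)) \<bullet> (k *\<^sub>R x + s *\<^sub>R (a *\<^sub>R e + b *\<^sub>R f))
        = k\<^sup>2 + s\<^sup>2 * (a\<^sup>2 + b\<^sup>2)" for a b
      by (simp add: inner_simps ef power2_eq_square algebra_simps)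
    from this[of "cos t" "sin t"] have "p t \<bullet> p t = k\<^sup>2 + s\<^sup>2" by (simp add: p_def)
    then have np: "norm (p t) = 1" by (simp add: norm_eq_1 s)
    then obtain y where y: "y \<in> M" "y \<noteq> x" "k \<le> y \<bullet> p t"
      using contra xp by (auto simp: not_less)
    have "x + y = (2 * k) *\<^sub>R p t"
      using M y np k xp sep by (intro caps_contact_point) auto
    then show ?thesis using y(1) k by (intro image_eqI[of _ _ y]) auto
  qed
  then have "p ` {0..1} \<subseteq> (\<lambda>y. (x + y) /\<^sub>R (2 * k)) ` M" by blast
  then show False using inf M(1) finite_subset by blast
qed

text \<open>If the cap around a point at angle \<alpha> has radius \<theta>, its boundary point at
  \<open>\<alpha> + \<theta>\<close> lies in a second closed cap, and the contact formula puts the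
  centre of that cap at \<open>\<alpha> + 2 * \<theta>\<close>. So \<open>M\<close> is closed under
  rotation by \<open>\<phi> = 2 * \<theta>\<close>, and the separation leaves no room for further
  points in between.\<close>

lemma regular_polygon_of_covered_boundary:
  fixes M :: "'a::euclidean_space set"
  assumes M: "finite M" "\<And>y. y \<in> M \<Longrightarrow> norm y = 1" "M \<noteq> {}" and dim: "DIM('a) = 2" and k: "0 < k" "k < 1"
    and sep: "\<And>x y. x \<in> M \<Longrightarrow> y \<in> M \<Longrightarrow> x \<noteq> y \<Longrightarrow> x \<bullet> y \<le> 2 * k\<^sup>2 - 1"
    and covered: "\<And>x p. x \<in> M \<Longrightarrow> norm p = 1 \<Longrightarrow> x \<bullet> p = k \<Longrightarrow> \<exists>y\<in>M. y \<noteq> x \<and> k \<le> y \<bullet> p"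
  shows "regular_polygon M"
proof -
  obtain e where eM: "e \<in> M" using M by blast
  obtain f' where f': "f' \<noteq> 0" "e \<bullet> f' = 0"
    using orthogonal_to_vector_exists[of e] dim by (auto simp: orthogonal_def)
  define f where "f = f' /\<^sub>R norm f'"
  have ne: "norm e = 1" "norm f = 1" using eM M f' by (auto simp: f_def)
  then have ef: "e \<bullet> e = 1" "f \<bullet> f = 1" "e \<bullet> f = 0" "f \<bullet> e = 0"
    unfolding norm_eq_1 using f' by (auto simp: f_def inner_commute)
  \<comment> \<open>A nonzero remainder would be a third orthogonal direction in dimension
    2.\<close>
  have expand: "v = (v \<bullet> e) *\<^sub>R e + (v \<bullet> f) *\<^sub>R f" for v
  proof (rule ccontr)
    define w where "w = v - (v \<bullet> e) *\<^sub>R e - (v \<bullet> f) *\<^sub>R f"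
    assume "v \<noteq> (v \<bullet> e) *\<^sub>R e + (v \<bullet> f) *\<^sub>R f"
    then have w: "w \<noteq> 0" by (simp add: w_def algebra_simps)
    have we: "w \<bullet> e = 0" "w \<bullet> f = 0" by (auto simp: w_def inner_simps ef)
    have "pairwise orthogonal {e, f, w}"
      using we ef by (auto simp: pairwise_def orthogonal_def inner_commute)
    then have "independent {e, f, w}"
      using w ne by (intro pairwise_orthogonal_independent) auto
    moreover have "card {e, f, w} = 3"
      using we ef w by (auto simp: card_insert_if)
    ultimately show False using independent_bound[of "{e, f, w}"] dim by simp
  qed
  define c where "c = (\<lambda>\<alpha>. cos \<alpha> *\<^sub>R e + sin \<alpha> *\<^sub>R f)"
  have cc: "c \<alpha> \<bullet> c \<beta> = cos (\<alpha> - \<beta>)" for \<alpha> \<beta>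
    by (simp add: c_def inner_simps ef cos_diff)
  then have nc: "norm (c \<alpha>) = 1" for \<alpha> by (simp add: norm_eq_1)
  have polar: "\<exists>\<alpha>. 0 \<le> \<alpha> \<and> \<alpha> < 2 * pi \<and> v = c \<alpha>" if "norm v = 1" for v
  proof -
    have "v \<bullet> v = (v \<bullet> e)\<^sup>2 + (v \<bullet> f)\<^sup>2"
      by (subst (1 2) expand[of v]) (simp add: inner_simps ef power2_eq_square)
    then have "(v \<bullet> e)\<^sup>2 + (v \<bullet> f)\<^sup>2 = 1" using that by (simp add: norm_eq_1)
    then obtain \<alpha> where "0 \<le> \<alpha>" "\<alpha> < 2 * pi" "v \<bullet> e = cos \<alpha>" "v \<bullet> f = sin \<alpha>"
      using sincos_total_2pi by blast
    then show ?thesis using expand[of v] by (auto simp: c_def)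
  qed
  define \<theta> where "\<theta> = arccos k"
  have \<theta>: "0 < \<theta>" "\<theta> < pi / 2" "cos \<theta> = k"
    using k arccos_lt_bounded[of k] arccos_less_arccos[of 0 k] by (auto simp: \<theta>_def)
  define \<phi> where "\<phi> = 2 * \<theta>"
  have \<phi>: "0 < \<phi>" "\<phi> < pi" "cos \<phi> = 2 * k\<^sup>2 - 1"
    using \<theta> by (auto simp: \<phi>_def cos_double_cos)
  have step: "c (\<alpha> + \<phi>) \<in> M" if c\<alpha>: "c \<alpha> \<in> M" for \<alpha>
  proof -
    have p: "c \<alpha> \<bullet> c (\<alpha> + \<theta>) = k" using cc \<theta> by simp
    obtain y where y: "y \<in> M" "y \<noteq> c \<alpha>" "k \<le> y \<bullet> c (\<alpha> + \<theta>)"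
      using covered[OF c\<alpha> nc p] by blast
    have "c \<alpha> + y = (2 * k) *\<^sub>R c (\<alpha> + \<theta>)"
      using M nc y k p c\<alpha> by (intro caps_contact_point sep) auto
    then have "y = (2 * k) *\<^sub>R c (\<alpha> + \<theta>) - c \<alpha>" by (simp add: algebra_simps)
    also have "\<dots> = c (\<alpha> + \<phi>)"
    proof -
      \<comment> \<open>Sum-to-product formulas with mean angle \<open>\<alpha> + \<theta>\<close>
        and half difference \<theta>, whose cosine is \<open>k\<close>.\<close>
      have mid: "(\<alpha> + \<phi> + \<alpha>) / 2 = \<alpha> + \<theta>" "(\<alpha> + \<phi> - \<alpha>) / 2 = \<theta>"
        by (simp_all add: \<phi>_def)
      have 1: "cos (\<alpha> + \<phi>) = 2 * k * cos (\<alpha> + \<theta>) - cos \<alpha>"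
        using cos_plus_cos[of "\<alpha> + \<phi>" \<alpha>] unfolding mid \<theta>(3) by (simp add: algebra_simps)
      have 2: "sin (\<alpha> + \<phi>) = 2 * k * sin (\<alpha> + \<theta>) - sin \<alpha>"
        using sin_plus_sin[of "\<alpha> + \<phi>" \<alpha>] unfolding mid \<theta>(3) by (simp add: algebra_simps)
      show ?thesis unfolding c_def 1 2 by (simp add: algebra_simps)
    qed
    finally show ?thesis using y(1) by simp
  qed
  have orbit: "c (real j * \<phi>) \<in> M" for j
  proof (induction j)
    case 0
    show ?case using eM by (simp add: c_def)
  next
    case (Suc j)
    then show ?case using step[of "real j * \<phi>"] by (simp add: algebra_simps)
  qed
  have multiple: "\<exists>j. \<alpha> = real j * \<phi>" if \<alpha>: "c \<alpha> \<in> M" "0 \<le> \<alpha>" for \<alpha>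
  proof -
    \<comment> \<open>Division with remainder by \<phi>: the remainder \<beta> is the angle between
      two points of \<open>M\<close> and is smaller than \<phi>. Separation makes these points
      coincide, so \<beta> is 0.\<close>
    define j where "j = nat \<lfloor>\<alpha> / \<phi>\<rfloor>"
    define \<beta> where "\<beta> = \<alpha> - real j * \<phi>"
    have j: "real j = of_int \<lfloor>\<alpha> / \<phi>\<rfloor>" using \<alpha> \<phi> by (simp add: j_def)
    have \<beta>: "0 \<le> \<beta>" "\<beta> < \<phi>"
      using floor_divide_lower[OF \<phi>(1), of \<alpha>] floor_divide_upper[OF \<phi>(1), of \<alpha>]
      by (auto simp: \<beta>_def j algebra_simps)
    have "cos \<phi> < cos \<beta>" using \<beta> \<phi> by (intro cos_monotone_0_pi) auto
    then have "\<not> c \<alpha> \<bullet> c (real j * \<phi>) \<le> 2 * k\<^sup>2 - 1" using cc \<phi> by (simp add: \<beta>_def)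
    then have "c \<alpha> = c (real j * \<phi>)" using sep[OF \<alpha>(1) orbit] by blast
    then have "cos \<beta> = 1" using cc[of \<alpha> "real j * \<phi>"] nc[of \<alpha>] by (simp add: \<beta>_def norm_eq_1)
    then have "\<beta> = 0" using cos_inj_pi[of \<beta> 0] \<beta> \<phi> by simp
    then show ?thesis by (auto simp: \<beta>_def)
  qed
  \<comment> \<open>A full turn returns to \<open>e\<close>, so it is also a multiple of \<phi>. The
    quotient \<open>K\<close> will be the number of vertices.\<close>
  have "c (2 * pi) \<in> M" using eM by (simp add: c_def)
  then obtain K where K: "2 * pi = real K * \<phi>" using multiple[of "2 * pi"] by auto
  have K0: "K > 0" using K by (cases K) auto
  have \<phi>K: "2 * pi * real j / real K = real j * \<phi>" for j using K K0 by (simp add: field_simps)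
  have img: "M = (\<lambda>j. c (real j * \<phi>)) ` {..<K}"
  proof (intro equalityI subsetI)
    fix v assume v: "v \<in> M"
    then obtain \<alpha> where \<alpha>: "0 \<le> \<alpha>" "\<alpha> < 2 * pi" "v = c \<alpha>" using polar[OF M(2)[OF v]] by blast
    obtain j where j: "\<alpha> = real j * \<phi>" using multiple[of \<alpha>] v \<alpha> by auto
    have "j < K" using \<alpha>(2) K \<phi>(1) unfolding j by simp
    then show "v \<in> (\<lambda>j. c (real j * \<phi>)) ` {..<K}" using j \<alpha> by auto
  qed (use orbit in auto)
  have "inj_on (\<lambda>j. c (real j * \<phi>)) {..<K}"
  proof (rule linorder_inj_onI')
    fix i j assume ij: "i \<in> {..<K}" "j \<in> {..<K}" "i < j"
    show "c (real i * \<phi>) \<noteq> c (real j * \<phi>)"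
    proof
      assume "c (real i * \<phi>) = c (real j * \<phi>)"
      then have "cos (real (j - i) * \<phi>) = 1"
        using cc[of "real j * \<phi>" "real i * \<phi>"] nc[of "real i * \<phi>"] ij
        by (simp add: norm_eq_1 of_nat_diff algebra_simps)
      then obtain l :: int where l: "real (j - i) * \<phi> = of_int l * 2 * pi"
        by (auto simp: cos_one_2pi_int)
      have "0 < real (j - i) * \<phi>" "real (j - i) * \<phi> < 2 * pi"
        using ij \<phi>(1) unfolding K by (auto simp: of_nat_diff)
      then have "0 < real_of_int l" "real_of_int l < 1" unfolding l by (auto simp: zero_less_mult_iff)
      then have "0 < l" "l < 1" by simp_all
      then show False by linarith
    qed
  qed
  then have "card M = K" unfolding img by (simp add: card_image)
  then show ?thesis
    unfolding regular_polygon_def using ne ef(3) img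
    by (intro exI[of _ e] exI[of _ f]) (simp add: \<phi>K c_def)
qed

section \<open>Degenerate configurations and the critical radius\<close>

lemma antipodal_pair_regular_polygon:
  fixes x :: "'a::euclidean_space"
  assumes x: "norm x = 1" and dim: "DIM('a) \<ge> 2"
  shows "regular_polygon {x, - x}"
proof -
  obtain f' where f': "f' \<noteq> 0" "x \<bullet> f' = 0"
    using orthogonal_to_vector_exists[of x] dim by (auto simp: orthogonal_def)
  have "x \<bullet> x \<noteq> x \<bullet> (- x)" using x by (simp add: norm_eq_1)
  then have "x \<noteq> - x" by metis
  then have "card {x, - x} = 2" by simp
  moreover have "{..<2} = {0, 1::nat}" by auto
  ultimately show ?thesis
    unfolding regular_polygon_def using x f'
    by (intro exI[of _ x] exI[of _ "f' /\<^sub>R norm f'"]) simp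
qed

text \<open>If any two distinct points were antipodal, \<open>M\<close> would be
  \<open>{x, - x}\<close>, the excluded polygon with two vertices. A non-antipodal pair later keeps
  the critical radius below a right angle and makes two half-spaces overlap.\<close>

lemma exists_non_antipodal_pair:
  fixes M :: "'a::euclidean_space set"
  assumes M: "card M \<ge> 2" "\<And>y. y \<in> M \<Longrightarrow> norm y = 1" and dim: "DIM('a) \<ge> 2"
    and nd: "\<not> (regular_polygon M \<and> card M = 2)"
  shows "\<exists>x\<in>M. \<exists>y\<in>M. x \<noteq> y \<and> x \<noteq> - y"
proof (rule ccontr)
  assume *: "\<not> ?thesis"
  have "M \<noteq> {}" using M(1) by auto
  then obtain x where x: "x \<in> M" by blast
  have "M \<subseteq> {x, - x}" using * x by (auto simp: minus_equation_iff[of x])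
  moreover have "card {x, - x} \<le> 2" by (simp add: card_insert_if)
  ultimately have "M = {x, - x}"
    using M(1) by (intro card_seteq) auto
  with nd have "card M \<noteq> 2"
    using antipodal_pair_regular_polygon[of x] x M(2) dim by simp
  then show False using M(1) \<open>card {x, - x} \<le> 2\<close> unfolding \<open>M = {x, - x}\<close> by simp
qed

text \<open>Distinct unit vectors have inner product below 1, so the maximal correlation \<rho> is
  below 1. The non-antipodal pair forces it above -1. With \<open>k\<close> the cosine of the
  critical radius, \<open>2 * k\<^sup>2 - 1\<close> is \<rho> itself.\<close>

lemma cos_critical_radius:
  fixes M :: "'a::euclidean_space set"
  assumes fin: "finite M" and M: "\<And>y. y \<in> M \<Longrightarrow> norm y = 1"
    and xy: "x \<in> M" "y \<in> M" "x \<noteq> y" "x \<noteq> - y"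
  shows "0 < cos (critical_radius M)" "cos (critical_radius M) < 1"
    "\<And>a b. a \<in> M \<Longrightarrow> b \<in> M \<Longrightarrow> a \<noteq> b \<Longrightarrow> a \<bullet> b \<le> 2 * (cos (critical_radius M))\<^sup>2 - 1"
proof -
  define S where "S = {x \<bullet> y | x y. x \<in> M \<and> y \<in> M \<and> x \<noteq> y}"
  have "S \<subseteq> (\<lambda>(x, y). x \<bullet> y) ` (M \<times> M)" by (auto simp: S_def)
  then have finS: "finite S" using fin by (meson finite_SigmaI finite_imageI finite_subset)
  define \<rho> where "\<rho> = max_correlation M"
  have \<rho>: "\<rho> = Max S" by (simp add: \<rho>_def max_correlation_def S_def)
  have le: "a \<bullet> b \<le> \<rho>" if "a \<in> M" "b \<in> M" "a \<noteq> b" for a b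
    unfolding \<rho> using that by (intro Max_ge finS) (auto simp: S_def)
  have lt: "a \<bullet> b < 1" if "norm a = 1" "norm b = 1" "a \<noteq> b" for a b :: 'a
  proof -
    have "(norm (a - b))\<^sup>2 = 2 - 2 * (a \<bullet> b)"
      using that unfolding power2_norm_eq_inner by (simp add: inner_simps norm_eq_1 inner_commute)
    moreover have "(norm (a - b))\<^sup>2 > 0" using that by simp
    ultimately show ?thesis by linarith
  qed
  have "x \<bullet> (- y) < 1" using lt[of x "- y"] xy M by auto
  then have gt: "-1 < \<rho>" using le[OF xy(1-3)] by simp
  have "\<rho> \<in> S" unfolding \<rho> using xy by (intro Max_in finS) (auto simp: S_def)
  then have lt1: "\<rho> < 1" using lt M by (auto simp: S_def)
  have c: "cos (critical_radius M) = sqrt ((1 + \<rho>) / 2)"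
    unfolding critical_radius_def \<rho>_def[symmetric] using gt lt1
    by (intro cos_arccos) (auto intro: order_trans[of _ 0])
  show "0 < cos (critical_radius M)" "cos (critical_radius M) < 1"
    unfolding c using gt lt1 by auto
  show "a \<bullet> b \<le> 2 * (cos (critical_radius M))\<^sup>2 - 1" if "a \<in> M" "b \<in> M" "a \<noteq> b" for a b
    unfolding c using le[OF that] gt by (simp add: field_simps)
qed

text \<open>A boundary point of one cap that no other closed cap contains exists in the plane unless
  \<open>M\<close> is a regular polygon, and always from dimension 3 on. Perturbing it gives the
  direction whose neighbourhood makes the lower bound strict.\<close>

lemma exists_uncovered_direction:
  fixes M :: "'a::euclidean_space set"
  assumes fin: "finite M" and M: "\<And>y. y \<in> M \<Longrightarrow> norm y = 1" "M \<noteq> {}" and dim: "DIM('a) \<ge> 2"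
    and k: "0 < k" "k < 1"
    and sep: "\<And>x y. x \<in> M \<Longrightarrow> y \<in> M \<Longrightarrow> x \<noteq> y \<Longrightarrow> x \<bullet> y \<le> 2 * k\<^sup>2 - 1"
    and nd: "\<not> (regular_polygon M \<and> DIM('a) = 2)"
  shows "\<exists>x\<in>M. \<exists>z. norm z = 1 \<and> 0 < x \<bullet> z \<and> (\<forall>y\<in>M. y \<bullet> z < k)"
proof -
  have "\<exists>x\<in>M. \<exists>p. norm p = 1 \<and> x \<bullet> p = k \<and> (\<forall>y\<in>M. y \<noteq> x \<longrightarrow> y \<bullet> p < k)"
  proof (cases "DIM('a) = 2")
    case True
    show ?thesis
    proof (rule ccontr)
      assume *: "\<not> ?thesis"
      have "regular_polygon M"
      proof (rule regular_polygon_of_covered_boundary[OF fin M True k])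
        show "x \<bullet> y \<le> 2 * k\<^sup>2 - 1" if "x \<in> M" "y \<in> M" "x \<noteq> y" for x y
          using sep that .
        show "\<exists>y\<in>M. y \<noteq> x \<and> k \<le> y \<bullet> p" if "x \<in> M" "norm p = 1" "x \<bullet> p = k" for x p
        proof -
          have "\<not> (\<forall>y\<in>M. y \<noteq> x \<longrightarrow> y \<bullet> p < k)" using * that by blast
          then show ?thesis by (auto simp: not_less)
        qed
      qed
      then show False using nd True by simp
    qed
  next
    case False
    then have dim3: "DIM('a) \<ge> 3" using dim by simp
    obtain x where x: "x \<in> M" using M(2) by blast
    have "\<exists>p. norm p = 1 \<and> x \<bullet> p = k \<and> (\<forall>y\<in>M. y \<noteq> x \<longrightarrow> y \<bullet> p < k)"
      using sep x by (intro exists_free_cap_boundary_point fin M(1) dim3 k) auto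
    with x show ?thesis by blast
  qed
  then obtain x p where x: "x \<in> M" and p: "norm p = 1" "x \<bullet> p = k"
    and free: "\<And>y. y \<in> M \<Longrightarrow> y \<noteq> x \<Longrightarrow> y \<bullet> p < k" by blast
  from cap_boundary_perturb[OF fin M(1)[OF x] p(1) k p(2) free] x show ?thesis by blast
qed

section \<open>Regularly varying tails\<close>

text \<open>On rectangles the claim is the product formula for the two generated sigma algebras, and
  rectangles determine the product measure.\<close>

lemma (in prob_space) distr_pair_eq_of_indep_set:
  assumes [measurable]: "X \<in> measurable M S" "Y \<in> measurable M T"
    and ind: "indep_set (sets (vimage_algebra (space M) X S)) (sets (vimage_algebra (space M) Y T))"
  shows "distr M (S \<Otimes>\<^sub>M T) (\<lambda>\<omega>. (X \<omega>, Y \<omega>)) = distr M S X \<Otimes>\<^sub>M distr M T Y"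
proof (rule pair_measure_eqI[symmetric])
  show "sigma_finite_measure (distr M S X)" "sigma_finite_measure (distr M T Y)"
    by (auto intro!: prob_space_imp_sigma_finite prob_space_distr)
  fix A B assume "A \<in> sets (distr M S X)" "B \<in> sets (distr M T Y)"
  then have [measurable]: "A \<in> sets S" "B \<in> sets T" by auto
  have "X -` A \<inter> space M \<in> sets (vimage_algebra (space M) X S)"
    "Y -` B \<inter> space M \<in> sets (vimage_algebra (space M) Y T)"
    by (auto intro!: in_vimage_algebra)
  then have "prob ((X -` A \<inter> space M) \<inter> (Y -` B \<inter> space M)) = prob (X -` A \<inter> space M) * prob (Y -` B \<inter> space M)"
    by (rule indep_setD[OF ind])
  moreover have "(\<lambda>\<omega>. (X \<omega>, Y \<omega>)) -` (A \<times> B) \<inter> space M = (X -` A \<inter> space M) \<inter> (Y -` B \<inter> space M)"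
    by auto
  ultimately show "emeasure (distr M S X) A * emeasure (distr M T Y) B =
      emeasure (distr M (S \<Otimes>\<^sub>M T) (\<lambda>\<omega>. (X \<omega>, Y \<omega>))) (A \<times> B)"
    by (simp add: emeasure_distr emeasure_eq_measure ennreal_mult')
qed simp

text \<open>The events of the theorem are closed half-lines, whereas regular variation speaks of
  open ones. The closed tail at \<open>s * t\<close> lies between the open tails at
  \<open>s * t\<close> and at \<open>a * s * t\<close> with \<open>a < 1\<close>. As a tends to 1
  the two limits agree, by continuity of the power.\<close>

lemma closed_tail_regularly_varying:
  fixes M :: "real measure" and \<alpha> :: real
  assumes "finite_measure M" and M: "sets M = sets borel"
    and rv: "\<And>s. s > 0 \<Longrightarrow> ((\<lambda>t. measure M {s * t<..} / measure M {t<..}) \<longlongrightarrow> s powr \<alpha>) at_top"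
    and s: "s > 0"
  shows "((\<lambda>t. measure M {s * t..} / measure M {t<..}) \<longlongrightarrow> s powr \<alpha>) at_top"
proof -
  interpret finite_measure M by fact
  show ?thesis
  proof (rule order_tendstoI)
    fix y assume "y < s powr \<alpha>"
    with rv[OF s] have "\<forall>\<^sub>F t in at_top. y < measure M {s * t<..} / measure M {t<..}"
      by (rule order_tendstoD)
    then show "\<forall>\<^sub>F t in at_top. y < measure M {s * t..} / measure M {t<..}"
    proof eventually_elim
      case (elim t)
      also have "measure M {s * t<..} / measure M {t<..} \<le> measure M {s * t..} / measure M {t<..}"
        by (intro divide_right_mono finite_measure_mono) (auto simp: M)
      finally show ?case .
    qed
  next
    fix y assume y: "s powr \<alpha> < y"
    have "((\<lambda>a. (a * s) powr \<alpha>) \<longlongrightarrow> (1 * s) powr \<alpha>) (at_left 1)"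
      using s by (intro tendsto_intros) auto
    then have "\<forall>\<^sub>F a in at_left 1. (a * s) powr \<alpha> < y"
      using y by (auto intro: order_tendstoD)
    moreover have "\<forall>\<^sub>F a in at_left 1. (0::real) < a" "\<forall>\<^sub>F a in at_left 1. a < (1::real)"
      by (auto intro!: eventually_at_leftI[of 0 1])
    ultimately have "\<forall>\<^sub>F a in at_left 1. (a * s) powr \<alpha> < y \<and> 0 < a \<and> a < 1"
      by eventually_elim auto
    then obtain a where a: "(a * s) powr \<alpha> < y" "0 < a" "a < 1"
      using eventually_happens'[of "at_left (1::real)"] by auto
    with s have "\<forall>\<^sub>F t in at_top. measure M {a * s * t<..} / measure M {t<..} < y"
      by (intro order_tendstoD(2)[OF rv]) auto
    then show "\<forall>\<^sub>F t in at_top. measure M {s * t..} / measure M {t<..} < y"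
      using eventually_gt_at_top[of 0]
    proof eventually_elim
      case (elim t)
      have "a * s * t < s * t" using a s elim by simp
      then have "measure M {s * t..} / measure M {t<..} \<le> measure M {a * s * t<..} / measure M {t<..}"
        by (intro divide_right_mono finite_measure_mono) (auto simp: M)
      with elim show ?case by simp
    qed
  qed
qed

text \<open>Fubini with the direction v fixed: positivity of \<open>v \<bullet> u\<close> allows the
  condition to be divided by it, which leaves a tail of the radius at
  \<open>c / (v \<bullet> u)\<close>. Measurability in v is recorded for dominated
  convergence.\<close>

lemma measure_pair_section:
  fixes R :: "real measure" and S :: "'a::euclidean_space measure"
  assumes R: "prob_space R" "sets R = sets borel" and S: "prob_space S" "sets S = sets borel"
    and A[measurable]: "A \<in> sets borel" and A_pos: "\<And>v. v \<in> A \<Longrightarrow> 0 < v \<bullet> u"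
  shows "measure (R \<Otimes>\<^sub>M S) {z. c \<le> fst z * (snd z \<bullet> u) \<and> snd z \<in> A} =
      (\<integral>v. indicator A v * measure R {c / (v \<bullet> u)..} \<partial>S)"
    and "(\<lambda>v. indicator A v * measure R {c / (v \<bullet> u)..}) \<in> borel_measurable S"
proof -
  interpret R: prob_space R by fact
  interpret S: prob_space S by fact
  interpret RS: pair_prob_space R S ..
  note [measurable_cong] = R(2) S(2)
  have space: "space R = UNIV" "space S = UNIV"
    using R(2) S(2) by (auto dest: sets_eq_imp_space_eq)
  let ?Z = "{z. c \<le> fst z * (snd z \<bullet> u) \<and> snd z \<in> A}"
  have Z: "?Z \<in> sets (R \<Otimes>\<^sub>M S)"
  proof -
    have "{z \<in> space (R \<Otimes>\<^sub>M S). c \<le> fst z * (snd z \<bullet> u) \<and> snd z \<in> A} \<in> sets (R \<Otimes>\<^sub>M S)"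
      by measurable
    then show ?thesis by (simp add: space_pair_measure space)
  qed
  have sec: "emeasure R ((\<lambda>x. (x, v)) -` ?Z) = ennreal (indicator A v * measure R {c / (v \<bullet> u)..})" for v
  proof (cases "v \<in> A")
    case True
    then have "(\<lambda>x. (x, v)) -` ?Z = {c / (v \<bullet> u)..}"
      using A_pos[OF True] by (auto simp: field_simps)
    then show ?thesis using True by (simp add: R.emeasure_eq_measure)
  qed simp
  have "(\<lambda>v. emeasure R ((\<lambda>x. (x, v)) -` ?Z)) \<in> borel_measurable S"
    using RS.measurable_emeasure_Pair2[OF Z] .
  then have meas: "(\<lambda>v. ennreal (indicator A v * measure R {c / (v \<bullet> u)..})) \<in> borel_measurable S"
    unfolding sec .
  then have "(\<lambda>v. enn2real (ennreal (indicator A v * measure R {c / (v \<bullet> u)..}))) \<in> borel_measurable S"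
    by measurable
  then show m: "(\<lambda>v. indicator A v * measure R {c / (v \<bullet> u)..}) \<in> borel_measurable S"
    by simp
  have "emeasure (R \<Otimes>\<^sub>M S) ?Z = (\<integral>\<^sup>+v. ennreal (indicator A v * measure R {c / (v \<bullet> u)..}) \<partial>S)"
    using RS.emeasure_pair_measure_alt2[OF Z] unfolding sec .
  then have "measure (R \<Otimes>\<^sub>M S) ?Z = enn2real (\<integral>\<^sup>+v. ennreal (indicator A v * measure R {c / (v \<bullet> u)..}) \<partial>S)"
    unfolding measure_def[of "R \<Otimes>\<^sub>M S"] by (rule arg_cong)
  also have "\<dots> = (\<integral>v. indicator A v * measure R {c / (v \<bullet> u)..} \<partial>S)"
    by (rule integral_eq_nn_integral[OF m, symmetric]) simp
  finally show "measure (R \<Otimes>\<^sub>M S) ?Z = (\<integral>v. indicator A v * measure R {c / (v \<bullet> u)..} \<partial>S)" .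
qed

text \<open>For a fixed direction the ratio of tails tends to
  \<open>(1 / (v \<bullet> u)) powr (- (2 * \<gamma>))\<close>, which is the integrand of the limit.
  On the sphere \<open>v \<bullet> u \<le> 1\<close>, so every ratio is dominated by the closed tail
  over the open tail at c. The index is doubled because \<open>R\<close> is the law of the radius,
  not of its square.\<close>

lemma tail_ratio_limit:
  fixes R :: "real measure" and S :: "'a::euclidean_space measure" and u :: 'a
  assumes R: "prob_space R" "sets R = sets borel" and S: "prob_space S" "sets S = sets borel"
    and AE_S: "AE v in S. norm v = 1" and u: "norm u = 1"
    and rv: "\<And>s. s > 0 \<Longrightarrow> ((\<lambda>t. measure R {s * t<..} / measure R {t<..}) \<longlongrightarrow> s powr (- (2 * \<gamma>))) at_top"
    and A[measurable]: "A \<in> sets borel" and A_pos: "\<And>v. v \<in> A \<Longrightarrow> 0 < v \<bullet> u"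
  shows "((\<lambda>c. measure (R \<Otimes>\<^sub>M S) {z. c \<le> fst z * (snd z \<bullet> u) \<and> snd z \<in> A} / measure R {c<..})
      \<longlongrightarrow> (\<integral>v. indicator A v * (v \<bullet> u) powr (2 * \<gamma>) \<partial>S)) at_top"
proof -
  interpret R: prob_space R by fact
  interpret S: prob_space S by fact
  note [measurable_cong] = S(2)
  note closed = closed_tail_regularly_varying[OF R.finite_measure_axioms R(2) rv]
  let ?f = "\<lambda>c v. indicator A v * measure R {c / (v \<bullet> u)..} / measure R {c<..}"
  have "((\<lambda>c. \<integral>v. ?f c v \<partial>S) \<longlongrightarrow> (\<integral>v. indicator A v * (v \<bullet> u) powr (2 * \<gamma>) \<partial>S)) at_top"
  proof (rule integral_dominated_convergence_at_top[where w = "\<lambda>_. 2"])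
    show "?f c \<in> borel_measurable S" for c
      using measure_pair_section(2)[OF R S A A_pos, of c] by (intro borel_measurable_divide) auto
    show "AE v in S. ((\<lambda>c. ?f c v) \<longlongrightarrow> indicator A v * (v \<bullet> u) powr (2 * \<gamma>)) at_top"
    proof (intro AE_I2)
      fix v
      show "((\<lambda>c. ?f c v) \<longlongrightarrow> indicator A v * (v \<bullet> u) powr (2 * \<gamma>)) at_top"
      proof (cases "v \<in> A")
        case True
        have "((\<lambda>c. measure R {(1 / (v \<bullet> u)) * c..} / measure R {c<..}) \<longlongrightarrow> (1 / (v \<bullet> u)) powr (- (2 * \<gamma>))) at_top"
          using A_pos[OF True] by (intro closed) auto
        moreover have "(1 / (v \<bullet> u)) powr (- (2 * \<gamma>)) = (v \<bullet> u) powr (2 * \<gamma>)"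
          using A_pos[OF True] by (simp add: powr_divide powr_minus_divide)
        ultimately show ?thesis using True by simp
      qed simp
    qed
    \<comment> \<open>This ratio tends to 1; the dominating constant 2 is just a number above that
      limit.\<close>
    have "\<forall>\<^sub>F c in at_top. measure R {1 * c..} / measure R {c<..} < 2"
      by (rule order_tendstoD(2)[OF closed]) auto
    then show "\<forall>\<^sub>F c in at_top. AE v in S. norm (?f c v) \<le> 2"
      using eventually_gt_at_top[of 0]
    proof eventually_elim
      case (elim c)
      from AE_S show ?case
      proof eventually_elim
        case v: (elim v)
        show ?case
        proof (cases "v \<in> A")
          case True
          have "v \<bullet> u \<le> 1" using norm_cauchy_schwarz[of v u] v u by simp
          then have "c \<le> c / (v \<bullet> u)" using A_pos[OF True] elim by (simp add: field_simps)
          then have "measure R {c / (v \<bullet> u)..} \<le> measure R {c..}"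
            by (intro R.finite_measure_mono) (auto simp: R)
          then have "measure R {c / (v \<bullet> u)..} / measure R {c<..} \<le> measure R {c..} / measure R {c<..}"
            by (intro divide_right_mono) auto
          then show ?thesis using elim True by simp
        qed simp
      qed
    qed
  qed (use A in \<open>auto intro!: borel_measurable_times simp: S(2)\<close>)
  moreover have "(\<integral>v. ?f c v \<partial>S) = measure (R \<Otimes>\<^sub>M S) {z. c \<le> fst z * (snd z \<bullet> u) \<and> snd z \<in> A} / measure R {c<..}" for c
    using measure_pair_section(1)[OF R S A A_pos, of c] by simp
  ultimately show ?thesis by (simp only:)
qed

section \<open>Passage to the product of a radial law and the uniform law on the sphere\<close>

lemma spherically_contoured_product_law:
  fixes \<xi> :: "'w \<Rightarrow> 'a::euclidean_space"
  assumes P: "prob_space P" and sc: "spherically_contoured P \<xi>"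
  obtains R :: "real measure" where "prob_space R" "sets R = sets borel" "AE x in R. x > 0"
    "\<xi> \<in> borel_measurable P"
    "distr P borel \<xi> = distr (R \<Otimes>\<^sub>M uniform_sphere) borel (\<lambda>z. fst z *\<^sub>R snd z)"
proof -
  interpret prob_space P by fact
  obtain r \<eta> where [measurable]: "r \<in> borel_measurable P" "\<eta> \<in> borel_measurable P"
    and ind: "indep_set (sets (vimage_algebra (space P) r borel)) (sets (vimage_algebra (space P) \<eta> borel))"
    and r: "AE \<omega> in P. r \<omega> > 0" and \<eta>: "distr P borel \<eta> = uniform_sphere"
    and \<xi>: "\<And>\<omega>. \<omega> \<in> space P \<Longrightarrow> \<xi> \<omega> = r \<omega> *\<^sub>R \<eta> \<omega>"
    using sc unfolding spherically_contoured_def by auto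
  show thesis
  proof (rule that[of "distr P borel r"])
    show "prob_space (distr P borel r)" by (rule prob_space_distr) simp
    show "AE x in distr P borel r. x > 0" using r by (subst AE_distr_iff) auto
    have "(\<lambda>\<omega>. r \<omega> *\<^sub>R \<eta> \<omega>) \<in> borel_measurable P" by measurable
    then show m: "\<xi> \<in> borel_measurable P" by (subst measurable_cong[OF \<xi>])
    have "distr P borel \<xi> = distr P borel (\<lambda>\<omega>. r \<omega> *\<^sub>R \<eta> \<omega>)"
      by (intro distr_cong refl \<xi>)
    also have "\<dots> = distr (distr P (borel \<Otimes>\<^sub>M borel) (\<lambda>\<omega>. (r \<omega>, \<eta> \<omega>))) borel (\<lambda>z. fst z *\<^sub>R snd z)"
      by (subst distr_distr) (simp_all add: comp_def)
    also have "distr P (borel \<Otimes>\<^sub>M borel) (\<lambda>\<omega>. (r \<omega>, \<eta> \<omega>)) = distr P borel r \<Otimes>\<^sub>M uniform_sphere"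
      using distr_pair_eq_of_indep_set[OF _ _ ind] by (simp add: \<eta>)
    finally show "distr P borel \<xi> = distr (distr P borel r \<Otimes>\<^sub>M uniform_sphere) borel (\<lambda>z. fst z *\<^sub>R snd z)" .
  qed simp
qed

lemma sets_pair_borel_uniform_sphere [measurable_cong]:
  "sets R = sets (borel :: real measure) \<Longrightarrow> sets (R \<Otimes>\<^sub>M uniform_sphere) = sets (borel \<Otimes>\<^sub>M borel)"
  by (intro sets_pair_measure_cong) simp_all

lemma space_pair_borel_uniform_sphere:
  "sets R = sets (borel :: real measure) \<Longrightarrow> space (R \<Otimes>\<^sub>M uniform_sphere) = UNIV"
  using sets_eq_imp_space_eq[of R borel] by (simp add: space_pair_measure)

lemma sets_half_space_cone:
  fixes R :: "real measure" and A :: "'a::euclidean_space set"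
  assumes R: "sets R = sets borel" and A: "A \<in> sets borel"
  shows "{z. c \<le> fst z * (snd z \<bullet> x) \<and> snd z \<in> A} \<in> sets (R \<Otimes>\<^sub>M uniform_sphere)"
proof -
  note [measurable] = A
  have "{z \<in> space (borel \<Otimes>\<^sub>M borel). c \<le> fst z * (snd z \<bullet> x) \<and> snd z \<in> A} \<in> sets (borel \<Otimes>\<^sub>M borel)"
    by measurable
  then show ?thesis
    unfolding sets_pair_borel_uniform_sphere[OF R] by (simp add: space_pair_measure)
qed

lemma AE_pair_uniform_sphere:
  fixes R :: "real measure"
  assumes R: "prob_space R" "sets R = sets borel" and R_pos: "AE t in R. t > 0"
  shows "AE z in R \<Otimes>\<^sub>M (uniform_sphere :: 'a::euclidean_space measure). 0 < fst z \<and> norm (snd z) = 1"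
proof -
  let ?S = "uniform_sphere :: 'a measure"
  interpret R: prob_space R by fact
  interpret S: prob_space ?S by (rule prob_space_uniform_sphere)
  interpret RS: pair_prob_space R ?S ..
  note [measurable_cong] = R(2)
  show ?thesis
  proof (rule RS.AE_pair_measure)
    show "{z \<in> space (R \<Otimes>\<^sub>M ?S). 0 < fst z \<and> norm (snd z) = 1} \<in> sets (R \<Otimes>\<^sub>M ?S)"
      by measurable
    show "AE t in R. AE v in ?S. 0 < fst (t, v) \<and> norm (snd (t, v)) = 1"
      using R_pos
    proof eventually_elim
      case (elim t)
      show ?case using AE_uniform_sphere by eventually_elim (use elim in simp)
    qed
  qed
qed

text \<open>The direction has norm 1 almost surely, so the squared norm of \<xi> is the squared
  radius, and positivity of the radius permits the square root.\<close>

lemma radial_tail: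
  fixes R :: "real measure" and \<xi> :: "'w \<Rightarrow> 'a::euclidean_space"
  assumes R: "prob_space R" "sets R = sets borel" and R_pos: "AE x in R. x > 0"
    and law: "distr P borel \<xi> = distr (R \<Otimes>\<^sub>M uniform_sphere) borel (\<lambda>z. fst z *\<^sub>R snd z)"
    and \<xi>: "\<xi> \<in> borel_measurable P" and x: "x \<ge> 0"
  shows "1 - cdf (distr P borel (\<lambda>\<omega>. (norm (\<xi> \<omega>))\<^sup>2)) x = measure R {sqrt x<..}"
proof -
  let ?S = "uniform_sphere :: 'a measure"
  interpret R: prob_space R by fact
  interpret S: prob_space ?S by (rule prob_space_uniform_sphere)
  interpret RS: pair_prob_space R ?S ..
  note [measurable] = \<xi> and [measurable_cong] = R(2)
  have "distr P borel (\<lambda>\<omega>. (norm (\<xi> \<omega>))\<^sup>2) = distr (distr P borel \<xi>) borel (\<lambda>v. (norm v)\<^sup>2)"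
    by (subst distr_distr) (simp_all add: comp_def)
  also have "\<dots> = distr (R \<Otimes>\<^sub>M ?S) borel (\<lambda>z. (norm (fst z *\<^sub>R snd z))\<^sup>2)"
    unfolding law by (subst distr_distr) (simp_all add: comp_def)
  also have "\<dots> = distr (R \<Otimes>\<^sub>M ?S) borel (\<lambda>z. (fst z)\<^sup>2)"
  proof (rule distr_cong_AE)
    show "AE z in R \<Otimes>\<^sub>M ?S. (norm (fst z *\<^sub>R snd z))\<^sup>2 = (fst z)\<^sup>2"
      using AE_pair_uniform_sphere[OF R R_pos] by eventually_elim (simp add: power_mult_distrib)
  qed simp_all
  also have "\<dots> = distr R borel (\<lambda>x. x\<^sup>2)"
  proof -
    have "distr R borel (\<lambda>x. x\<^sup>2) = distr (distr (R \<Otimes>\<^sub>M ?S) R fst) borel (\<lambda>x. x\<^sup>2)"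
      using S.distr_pair_fst[of R] R.sigma_finite_measure_axioms by simp
    then show ?thesis by (simp add: distr_distr comp_def)
  qed
  finally have "cdf (distr P borel (\<lambda>\<omega>. (norm (\<xi> \<omega>))\<^sup>2)) x = measure R ((\<lambda>x. x\<^sup>2) -` {..x} \<inter> space R)"
    unfolding cdf_def by (simp add: measure_distr)
  also have "1 - \<dots> = measure R (space R - (\<lambda>x. x\<^sup>2) -` {..x} \<inter> space R)"
    by (subst R.prob_compl[symmetric]) (auto intro: measurable_sets)
  also have "\<dots> = measure R {sqrt x<..}"
  proof (rule R.finite_measure_eq_AE)
    have [simp]: "space R = UNIV" using R(2) by (auto dest: sets_eq_imp_space_eq)
    show "AE t in R. (t \<in> space R - (\<lambda>x. x\<^sup>2) -` {..x} \<inter> space R) = (t \<in> {sqrt x<..})"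
      using R_pos
    proof eventually_elim
      case (elim t)
      have "x < t\<^sup>2 \<longleftrightarrow> sqrt x < t"
        using real_sqrt_less_iff[of x "t\<^sup>2"] elim by simp
      then show ?case by (auto simp: not_le)
    qed
    show "space R - (\<lambda>x. x\<^sup>2) -` {..x} \<inter> space R \<in> sets R"
      by (intro sets.compl_sets measurable_sets[of _ R borel]) measurable
    show "{sqrt x<..} \<in> sets R" by (simp add: R)
  qed
  finally show ?thesis .
qed

section \<open>Bounds for the probability of the union\<close>

lemma half_space_tail_eq:
  fixes R :: "real measure" and x y :: "real ^ 'n"
  assumes R: "prob_space R" "sets R = sets borel" and xy: "norm x = norm y"
  shows "measure (R \<Otimes>\<^sub>M uniform_sphere) {z. c \<le> fst z * (snd z \<bullet> x)} =
    measure (R \<Otimes>\<^sub>M uniform_sphere) {z. c \<le> fst z * (snd z \<bullet> y)}"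
proof -
  let ?S = "uniform_sphere :: (real ^ 'n) measure"
  interpret R: prob_space R by fact
  interpret S: prob_space ?S by (rule prob_space_uniform_sphere)
  interpret RS: pair_prob_space R ?S ..
  \<comment> \<open>At a fixed radius the event depends on the direction only through its inner
    product with \<open>w\<close>, whose law is the same for all vectors of equal norm.\<close>
  have "emeasure (R \<Otimes>\<^sub>M ?S) {z. c \<le> fst z * (snd z \<bullet> w)} =
      (\<integral>\<^sup>+t. emeasure (distr ?S borel (\<lambda>v. v \<bullet> w)) {s. c \<le> t * s} \<partial>R)" for w
  proof -
    have "{z. c \<le> fst z * (snd z \<bullet> w)} \<in> sets (R \<Otimes>\<^sub>M ?S)"
      using sets_half_space_cone[OF R(2), of UNIV] by simp
    from S.emeasure_pair_measure_alt[OF this] show ?thesis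
      by (simp add: emeasure_distr vimage_def)
  qed
  then show ?thesis
    unfolding measure_def using distr_uniform_sphere_inner[OF xy] by simp
qed

text \<open>The union bound is applied after removing from \<open>H y\<close> its overlap with
  \<open>H x\<close>. The overlap has positive probability: it contains all sufficiently long
  vectors with direction near the bisector of \<open>x\<close> and \<open>y\<close>. No limit is
  involved, so the bound holds for every \<open>c > 0\<close>.\<close>

lemma union_tail_less:
  fixes R :: "real measure" and M :: "(real ^ 'n) set"
  assumes R: "prob_space R" "sets R = sets borel" and R_tail: "\<And>t. t > 0 \<Longrightarrow> measure R {t<..} > 0"
    and M: "finite M" "\<And>x. x \<in> M \<Longrightarrow> norm x = 1"
    and xy: "x \<in> M" "y \<in> M" "x \<noteq> y" "x \<noteq> - y" and w: "w \<in> M" and c: "c > 0"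
  shows "measure (R \<Otimes>\<^sub>M uniform_sphere) {z. \<exists>x\<in>M. c \<le> fst z * (snd z \<bullet> x)} <
    real (card M) * measure (R \<Otimes>\<^sub>M uniform_sphere) {z. c \<le> fst z * (snd z \<bullet> w)}"
proof -
  let ?S = "uniform_sphere :: (real ^ 'n) measure"
  interpret R: prob_space R by fact
  interpret S: prob_space ?S by (rule prob_space_uniform_sphere)
  interpret RS: pair_prob_space R ?S ..
  define H where "H = (\<lambda>x :: real ^ 'n. {z :: real \<times> (real ^ 'n). c \<le> fst z * (snd z \<bullet> x)})"
  have H[measurable]: "H x \<in> sets (R \<Otimes>\<^sub>M ?S)" for x
    using sets_half_space_cone[OF R(2), of UNIV] by (simp add: H_def)
  have eq: "RS.prob (H a) = RS.prob (H w)" if "a \<in> M" for a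
    unfolding H_def using M(2)[OF that] M(2)[OF w] by (intro half_space_tail_eq R) simp
  have overlap: "RS.prob (H x \<inter> H y) > 0"
  proof -
    have nn: "norm x = 1" "norm y = 1" using M xy by auto
    have "x + y \<noteq> 0" using xy(4) by (metis add_eq_0_iff2)
    have "(norm (x + y))\<^sup>2 = 2 * (1 + x \<bullet> y)"
      using nn unfolding power2_norm_eq_inner by (simp add: inner_simps norm_eq_1 inner_commute)
    then have pos: "1 + x \<bullet> y > 0" using \<open>x + y \<noteq> 0\<close> by (smt (verit) zero_less_norm_iff zero_less_power)
    define m where "m = (x + y) /\<^sub>R norm (x + y)"
    \<comment> \<open>\<open>s\<close> is half the common value of \<open>m \<bullet> x\<close> and
      \<open>m \<bullet> y\<close>. The bisector \<open>m\<close> thus lies in the open set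
      \<open>W\<close>, and a radius above \<open>c / s\<close> suffices for every direction in
      \<open>W\<close>.\<close>
    define s where "s = inverse (norm (x + y)) * (1 + x \<bullet> y) / 2"
    have s: "s > 0" using pos \<open>x + y \<noteq> 0\<close> by (simp add: s_def)
    have mx: "m \<bullet> x = 2 * s" "m \<bullet> y = 2 * s"
    proof -
      have sum: "(x + y) \<bullet> x = 1 + x \<bullet> y" "(x + y) \<bullet> y = 1 + x \<bullet> y"
        using nn by (simp_all add: inner_add_left norm_eq_1 inner_commute[of y x])
      then show "m \<bullet> x = 2 * s" "m \<bullet> y = 2 * s"
        unfolding m_def s_def inner_scaleR_left sum by simp_all
    qed
    define W where "W = {v. s < v \<bullet> x} \<inter> {v. s < v \<bullet> y}"
    have "open W" unfolding W_def by (intro open_Int open_Collect_less continuous_intros)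
    moreover have "m \<in> W" using mx s by (simp add: W_def)
    ultimately have "emeasure ?S W > 0"
      using \<open>x + y \<noteq> 0\<close> by (intro emeasure_uniform_sphere_open_pos[of _ m]) (auto simp: m_def)
    then have W: "measure ?S W > 0" by (simp add: S.emeasure_eq_measure)
    have "W \<in> sets ?S" using \<open>open W\<close> by simp
    then have "RS.prob ({c / s<..} \<times> W) = measure R {c / s<..} * measure ?S W"
      using S.emeasure_pair_measure_Times[of "{c / s<..}" R W] R
      by (simp add: measure_def enn2real_mult)
    also have "\<dots> > 0" using W R_tail[of "c / s"] c s by simp
    finally have "RS.prob ({c / s<..} \<times> W) > 0" .
    moreover have "{c / s<..} \<times> W \<subseteq> H x \<inter> H y"
    proof -
      have "c \<le> t * b" if "c / s < t" "s < b" for t b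
      proof -
        have "t > 0" using that(1) c s by (smt (verit) divide_pos_pos)
        have "c \<le> t * s" using that(1) s by (simp add: pos_divide_less_eq)
        also have "\<dots> \<le> t * b" using that \<open>t > 0\<close> by simp
        finally show ?thesis .
      qed
      then show ?thesis by (auto simp: H_def W_def)
    qed
    then have "RS.prob ({c / s<..} \<times> W) \<le> RS.prob (H x \<inter> H y)"
      by (intro RS.finite_measure_mono sets.Int H) auto
    ultimately show ?thesis by simp
  qed
  have "{z. \<exists>x\<in>M. c \<le> fst z * (snd z \<bullet> x)} = (\<Union>a\<in>M - {y}. H a) \<union> (H y - H x \<inter> H y)"
    using xy by (auto simp: H_def)
  then have "RS.prob {z. \<exists>x\<in>M. c \<le> fst z * (snd z \<bullet> x)} \<le> RS.prob (\<Union>a\<in>M - {y}. H a) + RS.prob (H y - H x \<inter> H y)"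
    using M(1) H by (auto intro!: measure_Un_le sets.finite_UN simp del: sets_uniform_sphere)
  also have "RS.prob (\<Union>a\<in>M - {y}. H a) \<le> (\<Sum>a\<in>M - {y}. RS.prob (H a))"
    using M(1) H by (intro RS.finite_measure_subadditive_finite) (auto simp del: sets_uniform_sphere)
  also have "\<dots> = (\<Sum>a\<in>M - {y}. RS.prob (H w))"
    using eq by (intro sum.cong) auto
  also have "\<dots> = real (card M - 1) * RS.prob (H w)"
    using xy M(1) by simp
  also have "RS.prob (H y - H x \<inter> H y) = RS.prob (H y) - RS.prob (H x \<inter> H y)"
    by (intro RS.finite_measure_Diff sets.Int H) auto
  also have "RS.prob (H y) = RS.prob (H w)" using eq xy by auto
  also have "real (card M - 1) * RS.prob (H w) + (RS.prob (H w) - RS.prob (H x \<inter> H y)) <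
      real (card M) * RS.prob (H w)"
  proof -
    have "card M > 0" using M(1) xy by (auto simp: card_gt_0_iff)
    then show ?thesis using overlap by (simp add: of_nat_diff algebra_simps)
  qed
  finally show ?thesis by (simp add: H_def)
qed

text \<open>The union contains the parts of the half-spaces inside the disjoint caps, and a further
  part with directions in an open set \<open>U\<close> outside all closed caps. Divided by the
  radial tail, these tend to \<open>1 - \<Delta>\<close> times the sum of the half-space moments,
  plus \<open>I q U\<close>. The left-hand side has the first term alone as its limit, so the
  positive gap \<open>I q U\<close> gives strictness for large c.\<close>

lemma union_tail_lower_bound:
  fixes R :: "real measure" and M :: "(real ^ 'n) set"
  assumes R: "prob_space R" "sets R = sets borel" and R_tail: "\<And>t. t > 0 \<Longrightarrow> measure R {t<..} > 0"
    and rv: "\<And>s. s > 0 \<Longrightarrow> ((\<lambda>t. measure R {s * t<..} / measure R {t<..}) \<longlongrightarrow> s powr (- (2 * \<gamma>))) at_top"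
    and R_pos: "AE t in R. t > 0"
    and M: "finite M" "\<And>x. x \<in> M \<Longrightarrow> norm x = 1" and k: "k > 0" and \<gamma>: "\<gamma> > 0"
    and sep: "\<And>x y. x \<in> M \<Longrightarrow> y \<in> M \<Longrightarrow> x \<noteq> y \<Longrightarrow> x \<bullet> y \<le> 2 * k\<^sup>2 - 1"
    and q: "q \<in> M" "norm z0 = 1" "0 < z0 \<bullet> q" "\<And>y. y \<in> M \<Longrightarrow> z0 \<bullet> y < k"
    and w: "w \<in> M"
    and \<Delta>: "\<And>x. x \<in> M \<Longrightarrow> (\<integral>v. indicator {v. k < v \<bullet> x} v * (v \<bullet> x) powr (2 * \<gamma>) \<partial>uniform_sphere) =
      (1 - \<Delta>) * (\<integral>v. indicator {v. 0 < v \<bullet> w} v * (v \<bullet> w) powr (2 * \<gamma>) \<partial>uniform_sphere)"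
  shows "\<forall>\<^sub>F c in at_top. (1 - \<Delta>) * real (card M) * measure (R \<Otimes>\<^sub>M uniform_sphere) {z. c \<le> fst z * (snd z \<bullet> w)} <
    measure (R \<Otimes>\<^sub>M uniform_sphere) {z. \<exists>x\<in>M. c \<le> fst z * (snd z \<bullet> x)}"
proof -
  let ?S = "uniform_sphere :: (real ^ 'n) measure"
  interpret R: prob_space R by fact
  interpret S: prob_space ?S by (rule prob_space_uniform_sphere)
  interpret RS: pair_prob_space R ?S ..
  define D where "D = (\<lambda>c (x :: real ^ 'n) A. {z :: real \<times> (real ^ 'n). c \<le> fst z * (snd z \<bullet> x) \<and> snd z \<in> A})"
  define I where "I = (\<lambda>x A. \<integral>v. indicator A v * (v \<bullet> x) powr (2 * \<gamma>) \<partial>?S)"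
  have sphere: "AE v in ?S. norm v = 1" using AE_uniform_sphere by simp
  have D[measurable]: "D c x A \<in> sets (R \<Otimes>\<^sub>M ?S)" if "A \<in> sets borel" for c x A
    using sets_half_space_cone[OF R(2) that] by (simp add: D_def)
  have lim: "((\<lambda>c. RS.prob (D c x A) / measure R {c<..}) \<longlongrightarrow> I x A) at_top"
    if "x \<in> M" "A \<in> sets borel" "\<And>v. v \<in> A \<Longrightarrow> 0 < v \<bullet> x" for x A
    unfolding D_def I_def
    by (rule tail_ratio_limit) (use R rv S.prob_space_axioms sphere M that in auto)
  have cap: "{v. a < v \<bullet> x} \<in> sets borel" for a and x :: "real ^ 'n"
    by (intro borel_open open_Collect_less continuous_intros)
  \<comment> \<open>An open neighbourhood of \<open>z0\<close>; the condition on \<open>q\<close>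
    makes these directions contribute to the tail.\<close>
  define U where "U = {v. 0 < v \<bullet> q} \<inter> (\<Inter>y\<in>M. {v. v \<bullet> y < k})"
  have U: "open U"
    unfolding U_def using M(1) by (intro open_Int open_INT open_Collect_less continuous_intros ballI)
  have \<delta>: "I q U > 0"
  proof -
    have "emeasure ?S U > 0"
      using q by (intro emeasure_uniform_sphere_open_pos[OF U, of z0]) (auto simp: U_def)
    then have 1: "\<not> (AE v in ?S. v \<notin> U)"
      using U by (simp add: AE_iff_measurable[OF _ refl])
    have int: "integrable ?S (\<lambda>v. indicator U v * (v \<bullet> q) powr (2 * \<gamma>))"
    proof (rule S.integrable_const_bound[where B = "k powr (2 * \<gamma>)"])
      show "AE v in ?S. norm (indicator U v * (v \<bullet> q) powr (2 * \<gamma>)) \<le> k powr (2 * \<gamma>)"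
        using q(1) \<gamma> by (intro AE_I2) (auto simp: U_def powr_mono2 less_imp_le split: split_indicator)
      have [measurable]: "U \<in> sets borel" using U by simp
      show "(\<lambda>v. indicator U v * (v \<bullet> q) powr (2 * \<gamma>)) \<in> borel_measurable ?S" by measurable
    qed
    have "I q U \<ge> 0" unfolding I_def by (intro integral_nonneg_AE) auto
    moreover have "I q U \<noteq> 0"
    proof
      assume "I q U = 0"
      then have "AE v in ?S. indicator U v * (v \<bullet> q) powr (2 * \<gamma>) = 0"
        unfolding I_def by (subst (asm) integral_nonneg_eq_0_iff_AE[OF int]) auto
      then have "AE v in ?S. v \<notin> U"
        by eventually_elim (auto simp: U_def indicator_def split: if_splits)
      with 1 show False by simp
    qed
    ultimately show ?thesis by simp
  qed
  define p where "p = (\<lambda>c. RS.prob {z. c \<le> fst z * (snd z \<bullet> w)} / measure R {c<..})"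
  define Q where "Q = (\<lambda>c. (\<Sum>x\<in>M. RS.prob (D c x {v. k < v \<bullet> x}) / measure R {c<..}) + RS.prob (D c q U) / measure R {c<..})"
  have "((\<lambda>c. RS.prob (D c w {v. 0 < v \<bullet> w}) / measure R {c<..}) \<longlongrightarrow> I w {v. 0 < v \<bullet> w}) at_top"
    using w cap by (intro lim) auto
  \<comment> \<open>When c and the radius are positive, the event forces
    \<open>v \<bullet> w > 0\<close>. The limit for the open half-space is therefore that of the
    full tail.\<close>
  moreover have "\<forall>\<^sub>F c in at_top. RS.prob (D c w {v. 0 < v \<bullet> w}) / measure R {c<..} = p c"
    using eventually_gt_at_top[of 0]
  proof eventually_elim
    case (elim c)
    have "AE z in R \<Otimes>\<^sub>M ?S. fst z > 0"
      using AE_pair_uniform_sphere[OF R R_pos] by eventually_elim simp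
    then have "RS.prob (D c w {v. 0 < v \<bullet> w}) = RS.prob {z. c \<le> fst z * (snd z \<bullet> w)}"
    proof (intro RS.finite_measure_eq_AE, eventually_elim)
      fix z :: "real \<times> (real ^ 'n)" assume "0 < fst z"
      then show "(z \<in> D c w {v. 0 < v \<bullet> w}) = (z \<in> {z. c \<le> fst z * (snd z \<bullet> w)})"
        using elim by (auto simp: D_def) (smt (verit) zero_less_mult_iff)
    qed (use D[OF cap] D[of UNIV c w] in \<open>auto simp: D_def\<close>)
    then show ?case by (simp add: p_def)
  qed
  ultimately have p: "(p \<longlongrightarrow> I w {v. 0 < v \<bullet> w}) at_top"
    by (rule Lim_transform_eventually)
  have "(Q \<longlongrightarrow> (\<Sum>x\<in>M. I x {v. k < v \<bullet> x}) + I q U) at_top"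
    unfolding Q_def using k q U cap by (intro tendsto_add tendsto_sum lim) (auto simp: U_def)
  also have "(\<Sum>x\<in>M. I x {v. k < v \<bullet> x}) = (1 - \<Delta>) * real (card M) * I w {v. 0 < v \<bullet> w}"
    using \<Delta> by (simp add: I_def)
  finally have "((\<lambda>c. Q c - (1 - \<Delta>) * real (card M) * p c) \<longlongrightarrow>
      ((1 - \<Delta>) * real (card M) * I w {v. 0 < v \<bullet> w} + I q U) - (1 - \<Delta>) * real (card M) * I w {v. 0 < v \<bullet> w}) at_top"
    by (intro tendsto_intros p)
  then have "\<forall>\<^sub>F c in at_top. 0 < Q c - (1 - \<Delta>) * real (card M) * p c"
    by (rule order_tendstoD) (use \<delta> in simp)
  then show ?thesis
    using eventually_gt_at_top[of 0]
  proof eventually_elim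
    case (elim c)
    define L where "L = measure R {c<..}"
    have L: "L > 0" using R_tail elim by (simp add: L_def)
    have disj: "D c q U \<inter> (\<Union>x\<in>M. D c x {v. k < v \<bullet> x}) = {}"
      by (auto simp: D_def U_def)
    have "(\<Sum>x\<in>M. RS.prob (D c x {v. k < v \<bullet> x})) = RS.prob (\<Union>x\<in>M. D c x {v. k < v \<bullet> x})"
    proof (rule measure_UNION_AE[symmetric])
      \<comment> \<open>The cap events are disjoint only almost everywhere, because the geometric
        argument concerns directions of norm 1.\<close>
      have "AE z in R \<Otimes>\<^sub>M ?S. norm (snd z) = 1"
        using AE_pair_uniform_sphere[OF R R_pos] by eventually_elim simp
      then have "AE z in R \<Otimes>\<^sub>M ?S. z \<notin> D c x {v. k < v \<bullet> x} \<or> z \<notin> D c y {v. k < v \<bullet> y}"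
        if "x \<in> M" "y \<in> M" "x \<noteq> y" for x y
      proof eventually_elim
        case (elim z)
        show ?case
          using caps_disjoint[of x y "snd z" k] M that elim sep[of x y] k
          by (auto simp: D_def inner_commute)
      qed
      then show "pairwise (\<lambda>x y. AE z in R \<Otimes>\<^sub>M ?S. z \<notin> D c x {v. k < v \<bullet> x} \<or> z \<notin> D c y {v. k < v \<bullet> y}) M"
        by (auto simp: pairwise_def)
      show "D c x {v. k < v \<bullet> x} \<in> fmeasurable (R \<Otimes>\<^sub>M ?S)" for x
        unfolding RS.fmeasurable_eq_sets by (rule D[OF cap])
    qed (use M in auto)
    moreover have "RS.prob (\<Union>x\<in>M. D c x {v. k < v \<bullet> x}) + RS.prob (D c q U) =
        RS.prob ((\<Union>x\<in>M. D c x {v. k < v \<bullet> x}) \<union> D c q U)"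
      using disj M(1) D[OF cap] D[of U] U by (intro RS.finite_measure_Union[symmetric]) auto
    moreover have "\<dots> \<le> RS.prob {z. \<exists>x\<in>M. c \<le> fst z * (snd z \<bullet> x)}"
    proof (rule RS.finite_measure_mono)
      have "{z. \<exists>x\<in>M. c \<le> fst z * (snd z \<bullet> x)} = (\<Union>x\<in>M. D c x UNIV)" by (auto simp: D_def)
      then show "{z. \<exists>x\<in>M. c \<le> fst z * (snd z \<bullet> x)} \<in> sets (R \<Otimes>\<^sub>M ?S)"
        using M(1) D[of UNIV] by auto
    qed (use q in \<open>auto simp: D_def\<close>)
    ultimately have "Q c * L \<le> RS.prob {z. \<exists>x\<in>M. c \<le> fst z * (snd z \<bullet> x)}"
      using L by (simp add: Q_def L_def[symmetric] sum_divide_distrib[symmetric] add_divide_distrib[symmetric])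
    moreover have "(1 - \<Delta>) * real (card M) * p c * L < Q c * L"
      using elim L by (intro mult_strict_right_mono) auto
    moreover have "p c * L = RS.prob {z. c \<le> fst z * (snd z \<bullet> w)}"
      using L by (simp add: p_def L_def)
    ultimately show ?case by (simp add: mult.assoc)
  qed
qed

section \<open>Transfer to the product space and combination of the two bounds\<close>

theorem mainTheorem6:
  fixes P :: "'w measure"
    and \<xi> :: "'w \<Rightarrow> real ^ 'n"
    and u :: "nat \<Rightarrow> real ^ 'n"
    and N :: nat
    and \<gamma> \<Delta> :: real
  assumes "CARD('n) \<ge> 2"
    and "prob_space P"
    and "spherically_contoured P \<xi>"
    and "N \<ge> 2"
    and "inj_on u {1..N}"
    and "\<And>i. i \<in> {1..N} \<Longrightarrow> u i \<in> sphere 0 1"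
    and nondegenerate: "\<not> (regular_polygon (u ` {1..N}) \<and> (CARD('n) = 2 \<or> N = 2))"
    and "\<gamma> > 0"
    and "cdf (distr P borel (\<lambda>\<omega>. (norm (\<xi> \<omega>))\<^sup>2)) \<in> RV_neg \<gamma>"
    and "\<Delta> = measure (beta_distribution (\<gamma> + 1 / 2) ((real CARD('n) - 1) / 2))
                   {x. x < (cos (critical_radius (u ` {1..N})))\<^sup>2}"
  shows "\<forall>\<^sub>F c in at_top.
      (1 - \<Delta>) * real N * measure P {\<omega> \<in> space P. u 1 \<bullet> \<xi> \<omega> \<ge> c}
        < measure P {\<omega> \<in> space P. (MAX i\<in>{1..N}. u i \<bullet> \<xi> \<omega>) \<ge> c}
    \<and> measure P {\<omega> \<in> space P. (MAX i\<in>{1..N}. u i \<bullet> \<xi> \<omega>) \<ge> c}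
        < real N * measure P {\<omega> \<in> space P. u 1 \<bullet> \<xi> \<omega> \<ge> c}"
proof -
  interpret P: prob_space P by fact
  define M where "M = u ` {1..N}"
  have M: "finite M" "\<And>x. x \<in> M \<Longrightarrow> norm x = 1" and card_M: "card M = N"
    using assms(5,6) by (auto simp: M_def card_image)
  have u1: "u 1 \<in> M" using assms(4) by (auto simp: M_def)
  have dim: "DIM(real ^ 'n) \<ge> 2" using assms(1) by simp
  \<comment> \<open>The first exclusion yields a non-antipodal pair, used for the upper bound and
    for \<open>k > 0\<close>. The second yields the uncovered direction for the lower bound.\<close>
  have nd: "\<not> (regular_polygon M \<and> card M = 2)" "\<not> (regular_polygon M \<and> DIM(real ^ 'n) = 2)"
    using nondegenerate by (auto simp: card_M) (simp_all add: M_def)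
  obtain x y where xy: "x \<in> M" "y \<in> M" "x \<noteq> y" "x \<noteq> - y"
    using exists_non_antipodal_pair[of M] M dim nd(1) assms(4) card_M by blast
  define k where "k = cos (critical_radius M)"
  note k = cos_critical_radius[OF M xy, folded k_def]
  obtain q z0 where q: "q \<in> M" "norm z0 = 1" "0 < q \<bullet> z0" "\<And>y. y \<in> M \<Longrightarrow> y \<bullet> z0 < k"
    using exists_uncovered_direction[OF M _ dim k nd(2)] u1 by blast
  obtain R :: "real measure" where R: "prob_space R" "sets R = sets borel" and R_pos: "AE x in R. x > 0"
    and \<xi>[measurable]: "\<xi> \<in> borel_measurable P"
    and law: "distr P borel \<xi> = distr (R \<Otimes>\<^sub>M uniform_sphere) borel (\<lambda>z. fst z *\<^sub>R snd z)"
    using spherically_contoured_product_law[OF assms(2,3)] by blast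
  let ?Q = "R \<Otimes>\<^sub>M (uniform_sphere :: (real ^ 'n) measure)"
  define F where "F = cdf (distr P borel (\<lambda>\<omega>. (norm (\<xi> \<omega>))\<^sup>2))"
  have tail: "measure R {t<..} = 1 - F (t\<^sup>2)" if "t > 0" for t
    using radial_tail[OF R R_pos law \<xi>, of "t\<^sup>2"] that by (simp add: F_def)
  have F: "\<And>x. x > 0 \<Longrightarrow> F x < 1"
    "\<And>t. t > 0 \<Longrightarrow> ((\<lambda>x. (1 - F (t * x)) / (1 - F x)) \<longlongrightarrow> t powr (- \<gamma>)) at_top"
    using assms(9) by (auto simp: RV_neg_def F_def)
  have R_tail: "measure R {t<..} > 0" if "t > 0" for t
    using F(1)[of "t\<^sup>2"] that by (simp add: tail)
  \<comment> \<open>\<open>F\<close> describes the squared radius; substituting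
    \<open>t\<^sup>2\<close> turns the index \<open>- \<gamma>\<close> into
    \<open>- (2 * \<gamma>)\<close> for the radius.\<close>
  have rv: "((\<lambda>t. measure R {s * t<..} / measure R {t<..}) \<longlongrightarrow> s powr (- (2 * \<gamma>))) at_top" if s: "s > 0" for s
  proof -
    have "filterlim (\<lambda>t::real. t\<^sup>2) at_top at_top"
      by (rule filterlim_pow_at_top) (auto intro: filterlim_ident)
    then have "((\<lambda>t. (1 - F (s\<^sup>2 * t\<^sup>2)) / (1 - F (t\<^sup>2))) \<longlongrightarrow> (s\<^sup>2) powr (- \<gamma>)) at_top"
      using s by (intro filterlim_compose[OF F(2)]) simp_all
    also have "(s\<^sup>2) powr (- \<gamma>) = s powr (- (2 * \<gamma>))"
      using powr_powr[of s 2 "- \<gamma>"] s by simp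
    finally show ?thesis
    proof (rule Lim_transform_eventually)
      show "\<forall>\<^sub>F t in at_top. (1 - F (s\<^sup>2 * t\<^sup>2)) / (1 - F (t\<^sup>2)) = measure R {s * t<..} / measure R {t<..}"
        using eventually_gt_at_top[of 0]
        by eventually_elim (use s in \<open>simp add: tail power_mult_distrib\<close>)
    qed
  qed
  have transfer: "measure P {\<omega> \<in> space P. \<xi> \<omega> \<in> B} = measure ?Q {z. fst z *\<^sub>R snd z \<in> B}"
    if [measurable]: "B \<in> sets borel" for B
  proof -
    have "measure P {\<omega> \<in> space P. \<xi> \<omega> \<in> B} = measure (distr P borel \<xi>) B"
      by (subst measure_distr) (auto simp: vimage_def Int_def conj_commute)
    also have "\<dots> = measure ?Q {z. fst z *\<^sub>R snd z \<in> B}"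
      unfolding law using R(2)
      by (subst measure_distr) (auto simp: vimage_def space_pair_borel_uniform_sphere cong: measurable_cong_sets)
    finally show ?thesis .
  qed
  have event1: "measure P {\<omega> \<in> space P. u 1 \<bullet> \<xi> \<omega> \<ge> c} = measure ?Q {z. c \<le> fst z * (snd z \<bullet> u 1)}" for c
    using transfer[of "{v. c \<le> u 1 \<bullet> v}"] by (simp add: inner_commute)
  have event2: "measure P {\<omega> \<in> space P. (MAX i\<in>{1..N}. u i \<bullet> \<xi> \<omega>) \<ge> c} =
      measure ?Q {z. \<exists>x\<in>M. c \<le> fst z * (snd z \<bullet> x)}" for c
  proof -
    have "c \<le> (MAX i\<in>{1..N}. u i \<bullet> v) \<longleftrightarrow> (\<exists>x\<in>M. c \<le> x \<bullet> v)" for v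
      using assms(4) by (subst Max_ge_iff) (auto simp: M_def)
    moreover have "{v. \<exists>x\<in>M. c \<le> x \<bullet> v} = (\<Union>x\<in>M. {v. c \<le> x \<bullet> v})" by auto
    then have "{v. \<exists>x\<in>M. c \<le> x \<bullet> v} \<in> sets borel"
      using M(1) closed_halfspace_ge by (auto intro!: borel_closed closed_UN)
    ultimately show ?thesis
      using transfer[of "{v. \<exists>x\<in>M. c \<le> x \<bullet> v}"] by (simp add: inner_commute)
  qed
  have moment: "(\<integral>v. indicator {v. k < v \<bullet> x} v * (v \<bullet> x) powr (2 * \<gamma>) \<partial>uniform_sphere) =
      (1 - \<Delta>) * (\<integral>v. indicator {v. 0 < v \<bullet> u 1} v * (v \<bullet> u 1) powr (2 * \<gamma>) \<partial>uniform_sphere)" if "x \<in> M" for x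
  proof -
    \<comment> \<open>The half-space moment depends only on the law of one coordinate, so the moment
      around \<open>x\<close> may be replaced by the one around \<open>u 1\<close>.\<close>
    have half: "(\<integral>v. indicator {v. 0 < v \<bullet> w} v * (v \<bullet> w) powr (2 * \<gamma>) \<partial>uniform_sphere) =
        (\<integral>t. indicator {0<..} t * t powr (2 * \<gamma>) \<partial>distr uniform_sphere borel (\<lambda>v. v \<bullet> w))" for w :: "real ^ 'n"
      by (subst integral_distr) (auto simp: indicator_def)
    have "distr uniform_sphere borel (\<lambda>v. v \<bullet> x) = distr uniform_sphere borel (\<lambda>v. v \<bullet> u 1)"
      using M(2)[OF that] M(2)[OF u1] by (intro distr_uniform_sphere_inner) simp
    then show ?thesis
      using uniform_sphere_cap_moment[OF M(2)[OF that] assms(1,8), of k] k(1) assms(10)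
      by (simp add: half k_def M_def)
  qed
  have "\<forall>\<^sub>F c in at_top. (1 - \<Delta>) * real (card M) * measure ?Q {z. c \<le> fst z * (snd z \<bullet> u 1)} <
      measure ?Q {z. \<exists>x\<in>M. c \<le> fst z * (snd z \<bullet> x)}"
    using q by (intro union_tail_lower_bound[OF R R_tail rv R_pos M k(1) assms(8) k(3) _ _ _ _ u1 moment])
      (auto simp: inner_commute)
  then show ?thesis
    using eventually_gt_at_top[of 0]
  proof eventually_elim
    case (elim c)
    then show ?case
      using union_tail_less[OF R R_tail M xy u1 elim(2)] unfolding event1 event2 card_M by simp
  qed
qed

end
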